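(* Let $\mathcal{H}_1,\mathcal{H}_2,\mathcal{H}_3,\mathcal{H}_4$ be separable Hilbert spaces, $r\in\mathbb{N}$, $M\in L_2(\mathcal{H}_1,\mathcal{H}_4)$, $B\in\mathcal{B}(\mathcal{H}_3,\mathcal{H}_4)$, $C\in\mathcal{B}(\mathcal{H}_1,\mathcal{H}_2)$, and let the sets $\mathcal{X}_r(\cdot,\cdot)$ and $\mathcal{Y}_r(\cdot,\cdot,\cdot)$ be as defined in the context. Suppose that $Y\in\mathcal{B}(\mathcal{H}_1,\mathcal{H}_4)$ satisfies $Y^*\in\mathcal{Y}_r(M^*,C^*,B^* )$. Then $\hat X^a:=(C^* )^\dagger Y^*(B^* )^\dagger$ is a solution of the adjoint problem $$\min\{\|M^*-C^*XB^*\|_{L_2}:\ X\in\mathcal{X}_r(C^*,B^* )\}$$ satisfying $P_{\overline{\operatorname{ran}C}}XP_{(\ker B)^\perp}=X$ on $\operatorname{dom}(X)$. Furthermore: (i) $\hat X^a$ is bounded if and only if $Y\in\mathcal{Y}_r(M,B,C)$; (ii) if $Y\in\mathcal{Y}_r(M,B,C)$, then $\hat X^d:=B^\dagger YC^\dagger$ is a bounded solution of the direct problem $\min\{\|M-BXC\|_{L_2}:X\in\mathcal{X}_r(B,C)\}$ satisfying $X=P_{(\ker B)^\perp}XP_{\overline{\operatorname{ran}C}}$ on $\operatorname{dom}(X)$, and $\hat X^d=(\hat X^a)^*$.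
   Context: All Hilbert spaces are over a common field $\mathbb{R}$ or $\mathbb{C}$ and may be finite- or infinite-dimensional. A linear operator $T:\mathcal{H}\to\mathcal{K}$ is a linear map defined on a linear subspace $\operatorname{dom}(T)\subset\mathcal{H}$, possibly unbounded; $\operatorname{dom}(TS)=S^{-1}(\operatorname{dom}T)$. A bounded, densely defined operator is identified with its unique continuous extension to the whole space (in particular in forming adjoints and in the equality $\hat X^d=(\hat X^a)^*$). $\mathcal{B}(\mathcal{H},\mathcal{K})$ denotes the bounded everywhere-defined operators, $L_2(\mathcal{H},\mathcal{K})$ the Hilbert--Schmidt operators with norm $\|\cdot\|_{L_2}$, and $\mathcal{B}_{00,r}(\mathcal{H},\mathcal{K})$ the bounded operators with range of dimension at most $r$. $P_V$ is the orthogonal projector onto a closed subspace $V$. Moore--Penrose inverse: for $T\in\mathcal{B}(\mathcal{H},\mathcal{K})$, $\operatorname{dom}(T^\dagger)=\operatorname{ran}T\oplus(\operatorname{ran}T)^\perp$ and $T^\dagger(h+k)=(T|_{(\ker T)^\perp})^{-1}h$ for $h\in\operatorname{ran}T$, $k\in(\operatorname{ran}T)^\perp$. For Hilbert spaces $\mathcal{G}_1,\dots,\mathcal{G}_4$, $N\in L_2(\mathcal{G}_1,\mathcal{G}_4)$, $D\in\mathcal{B}(\mathcal{G}_3,\mathcal{G}_4)$, $E\in\mathcal{B}(\mathcal{G}_1,\mathcal{G}_2)$, define $$\mathcal{X}_r(D,E)=\{X:\mathcal{G}_2\to\mathcal{G}_3\text{ linear}:\ \operatorname{dom}(X)\supset\operatorname{dom}(E^\dagger),\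 \dim\operatorname{ran}X\le r,\ DXE\in L_2(\mathcal{G}_1,\mathcal{G}_4)\},$$ $$\mathcal{Y}_r(N,D,E)=\{Y\in\mathcal{B}_{00,r}(\mathcal{G}_1,\mathcal{G}_4):\ \operatorname{ran}Y\subset\operatorname{dom}(D^\dagger),\ \|K-Y\|_{L_2}\le\|K-\tilde Y\|_{L_2}\ \forall\tilde Y\in\mathcal{B}_{00,r}(\mathcal{G}_1,\mathcal{G}_4)\},$$ where $K=P_{\overline{\operatorname{ran}D}}NP_{(\ker E)^\perp}$. For $(N,D,E)=(M^*,C^*,B^* )$ one has $(\mathcal{G}_1,\mathcal{G}_2,\mathcal{G}_3,\mathcal{G}_4)=(\mathcal{H}_4,\mathcal{H}_3,\mathcal{H}_2,\mathcal{H}_1)$. *)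

theory Defs
  imports "HOL-Analysis.Analysis"
begin

section \<open>The scalar field\<close>

text \<open>
  The only models of this class, up to isomorphism, are the real and the complex numbers
  (already \<^class>\<open>real_normed_field\<close> leaves no other possibility, and the axioms determine
  \<open>kcnj\<close> and \<open>kre\<close>). Quantifying over a type of this class quantifies over the common field
  of all Hilbert spaces.
\<close>

class real_or_complex = real_normed_field +
  fixes kcnj :: "'a \<Rightarrow> 'a" and kre :: "'a \<Rightarrow> real"
  assumes kcnj_add: "kcnj (x + y) = kcnj x + kcnj y"
    and kcnj_mult: "kcnj (x * y) = kcnj x * kcnj y"
    and kcnj_scaleR_one: "kcnj (a *\<^sub>R 1) = a *\<^sub>R 1"
    and mult_kcnj: "x * kcnj x = (norm x)\<^sup>2 *\<^sub>R 1"
    and kre_scaleR_one: "kre x *\<^sub>R 1 = (x + kcnj x) / 2"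

instantiation real :: real_or_complex
begin
definition kcnj_real :: "real \<Rightarrow> real" where "kcnj_real x = x"
definition kre_real :: "real \<Rightarrow> real" where "kre_real x = x"
instance
  by standard (simp_all add: kcnj_real_def kre_real_def power2_eq_square)
end

instantiation complex :: real_or_complex
begin
definition kcnj_complex :: "complex \<Rightarrow> complex" where "kcnj_complex = cnj"
definition kre_complex :: "complex \<Rightarrow> real" where "kre_complex = Re"
instance
  by standard
    (simp_all add: kcnj_complex_def kre_complex_def complex_eq_iff cmod_power2
      power2_eq_square[symmetric])
end

section \<open>Hilbert spaces\<close>

text \<open>
  A Hilbert space over \<open>'k\<close> is a type of class \<^class>\<open>real_inner\<close> and \<^class>\<open>complete_space\<close>,
  which supplies addition, norm and topology, together with a scalar multiplication and an inner
  product with values in \<open>'k\<close>. No generality is lost by the class \<^class>\<open>real_inner\<close>: a Hilbert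
  space over \<open>'k\<close> is also a real one for the real part of its inner product, with the same norm.
\<close>

record ('k, 'h) hilbert =
  kscale :: "'k \<Rightarrow> 'h \<Rightarrow> 'h"
  kinner :: "'h \<Rightarrow> 'h \<Rightarrow> 'k"

locale hilbert_space = vector_space "kscale G"
  for G :: "('k::real_or_complex, 'h::{real_inner,complete_space}) hilbert" +
  assumes kscale_of_real: "kscale G (of_real a) x = a *\<^sub>R x"
    and kinner_add_left: "kinner G (x + y) z = kinner G x z + kinner G y z"
    and kinner_scale_left: "kinner G (kscale G c x) y = c * kinner G x y"
    and kinner_commute: "kinner G x y = kcnj (kinner G y x)"
    and kre_kinner: "kre (kinner G x y) = x \<bullet> y"

lemma hilbert_space_real:
  "hilbert_space \<lparr>kscale = scaleR, kinner = (\<bullet>)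
     :: 'h::{real_inner,complete_space} \<Rightarrow> 'h \<Rightarrow> real\<rparr>"
  by unfold_locales
    (simp_all add: algebra_simps inner_add_left inner_commute kcnj_real_def kre_real_def)

lemma hilbert_space_complex:
  "hilbert_space \<lparr>kscale = (*), kinner = (\<lambda>x y. x * cnj y) :: complex \<Rightarrow> complex \<Rightarrow> complex\<rparr>"
  by unfold_locales
    (simp_all add: algebra_simps scaleR_conv_of_real kcnj_complex_def kre_complex_def
      inner_complex_def)

definition orth :: "('k::real_or_complex, 'h::real_inner) hilbert \<Rightarrow> 'h set \<Rightarrow> 'h set" where
  "orth G S = {x. \<forall>s\<in>S. kinner G x s = 0}"

definition proj :: "('k::real_or_complex, 'h::real_inner) hilbert \<Rightarrow> 'h set \<Rightarrow> 'h \<Rightarrow> 'h" where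
  "proj G V x = (THE v. v \<in> V \<and> x - v \<in> orth G V)"

definition is_onb :: "('k::real_or_complex, 'h::real_inner) hilbert \<Rightarrow> 'h set \<Rightarrow> bool" where
  "is_onb G E \<longleftrightarrow>
     (\<forall>e\<in>E. \<forall>f\<in>E. kinner G e f = (if e = f then 1 else 0)) \<and>
     closure (module.span (kscale G) E) = UNIV"

text \<open>
  Not \<open>dim V \<le> r\<close> in terms of the library's \<open>dim\<close>, which is 0 for infinite-dimensional spaces.
\<close>

definition dim_at_most :: "('k::real_or_complex, 'h::real_inner) hilbert \<Rightarrow> nat \<Rightarrow> 'h set \<Rightarrow> bool"
  where
  "dim_at_most G r V \<longleftrightarrow>
     (\<exists>B. finite B \<and> card B \<le> r \<and> \<not> module.dependent (kscale G) B \<and>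
          module.span (kscale G) B = V)"

section \<open>Bounded and Hilbert--Schmidt operators\<close>

definition bounded_ops ::
  "('k::real_or_complex, 'g::real_inner) hilbert \<Rightarrow> ('k, 'h::real_inner) hilbert \<Rightarrow> ('g \<Rightarrow> 'h) set"
  where
  "bounded_ops G H =
     {T. Vector_Spaces.linear (kscale G) (kscale H) T \<and> (\<exists>c. \<forall>x. norm (T x) \<le> c * norm x)}"

definition adj ::
  "('k::real_or_complex, 'g::real_inner) hilbert \<Rightarrow> ('k, 'h::real_inner) hilbert \<Rightarrow>
     ('g \<Rightarrow> 'h) \<Rightarrow> ('h \<Rightarrow> 'g)" where
  "adj G H T = (THE S. \<forall>x y. kinner H (T x) y = kinner G x (S y))"

definition hs_ops ::
  "('k::real_or_complex, 'g::real_inner) hilbert \<Rightarrow> ('k, 'h::real_inner) hilbert \<Rightarrow> ('g \<Rightarrow> 'h) set"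
  where
  "hs_ops G H =
     {T \<in> bounded_ops G H. \<exists>E. is_onb G E \<and> (\<lambda>e. (norm (T e))\<^sup>2) summable_on E}"

text \<open>Neither \<open>hs_ops\<close> nor \<open>hs_norm\<close> depends on the chosen orthonormal basis.\<close>

definition hs_norm ::
  "('k::real_or_complex, 'g::real_inner) hilbert \<Rightarrow> ('g \<Rightarrow> 'h::real_inner) \<Rightarrow> real" where
  "hs_norm G T = sqrt (\<Sum>\<^sub>\<infinity>e\<in>(SOME E. is_onb G E). (norm (T e))\<^sup>2)"

definition finite_rank_ops ::
  "nat \<Rightarrow> ('k::real_or_complex, 'g::real_inner) hilbert \<Rightarrow> ('k, 'h::real_inner) hilbert \<Rightarrow>
     ('g \<Rightarrow> 'h) set" where
  "finite_rank_ops r G H = {T \<in> bounded_ops G H. dim_at_most H r (range T)}"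

section \<open>Possibly unbounded operators\<close>

text \<open>
  An operator that need not be everywhere defined is a partial function \<open>T :: 'g \<rightharpoonup> 'h\<close>. Thus
  \<^term>\<open>dom T\<close> and \<^term>\<open>ran T\<close> are its domain and range, equality of operators includes
  equality of domains, and composition is \<open>T \<circ>\<^sub>m S\<close>, whose domain consists of the points of
  \<open>dom S\<close> that \<open>S\<close> maps into \<open>dom T\<close>. A function \<open>f\<close> defined everywhere is viewed as such an
  operator through \<open>Some \<circ> f\<close>.
\<close>

definition linear_operator ::
  "('k::real_or_complex, 'g::real_inner) hilbert \<Rightarrow> ('k, 'h::real_inner) hilbert \<Rightarrow>
     ('g \<rightharpoonup> 'h) \<Rightarrow> bool" where
  "linear_operator G H T \<longleftrightarrow>
     module.subspace (kscale G) (dom T) \<and>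
     (\<forall>x\<in>dom T. \<forall>y\<in>dom T. the (T (x + y)) = the (T x) + the (T y)) \<and>
     (\<forall>c. \<forall>x\<in>dom T. the (T (kscale G c x)) = kscale H c (the (T x)))"

definition bounded_operator :: "('g::real_inner \<rightharpoonup> 'h::real_inner) \<Rightarrow> bool" where
  "bounded_operator T \<longleftrightarrow> (\<exists>c. \<forall>x\<in>dom T. norm (the (T x)) \<le> c * norm x)"

text \<open>The continuous extension to the whole space of a bounded, densely defined operator.\<close>

definition extension :: "('g::real_inner \<rightharpoonup> 'h::real_inner) \<Rightarrow> 'g \<Rightarrow> 'h" where
  "extension T = (THE S. continuous_on UNIV S \<and> T \<subseteq>\<^sub>m (Some \<circ> S))"

definition mp_inverse ::
  "('k::real_or_complex, 'g::real_inner) hilbert \<Rightarrow> ('k, 'h::real_inner) hilbert \<Rightarrow>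
     ('g \<Rightarrow> 'h) \<Rightarrow> ('h \<rightharpoonup> 'g)" where
  "mp_inverse G H T y =
     (if \<exists>h\<in>range T. \<exists>k\<in>orth H (range T). y = h + k
      then Some (THE x. \<exists>h\<in>range T. \<exists>k\<in>orth H (range T). y = h + k \<and>
                          x = inv_into (orth G (T -` {0})) T h)
      else None)"

section \<open>The approximation problems\<close>

text \<open>
  \<open>D X E\<close> for \<open>X\<close> with \<open>dom X \<supseteq> range E\<close>, where it is defined everywhere. Members of
  \<open>\<X>\<^sub>r(D,E)\<close> satisfy this, as the domain of the Moore--Penrose inverse of \<open>E\<close> contains \<open>range E\<close>.
\<close>

definition sandwich :: "('c \<Rightarrow> 'd) \<Rightarrow> ('b \<rightharpoonup> 'c) \<Rightarrow> ('a \<Rightarrow> 'b) \<Rightarrow> 'a \<Rightarrow> 'd" where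
  "sandwich D X E = (\<lambda>x. D (the (X (E x))))"

definition X_set ::
  "nat \<Rightarrow> ('k::real_or_complex, 'g1::real_inner) hilbert \<Rightarrow> ('k, 'g2::real_inner) hilbert \<Rightarrow>
     ('k, 'g3::real_inner) hilbert \<Rightarrow> ('k, 'g4::real_inner) hilbert \<Rightarrow>
     ('g3 \<Rightarrow> 'g4) \<Rightarrow> ('g1 \<Rightarrow> 'g2) \<Rightarrow> ('g2 \<rightharpoonup> 'g3) set" where
  "X_set r G1 G2 G3 G4 D E =
     {X. linear_operator G2 G3 X \<and>
         dom (mp_inverse G1 G2 E) \<subseteq> dom X \<and>
         dim_at_most G3 r (ran X) \<and>
         sandwich D X E \<in> hs_ops G1 G4}"

definition Y_set ::
  "nat \<Rightarrow> ('k::real_or_complex, 'g1::real_inner) hilbert \<Rightarrow> ('k, 'g2::real_inner) hilbert \<Rightarrow>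
     ('k, 'g3::real_inner) hilbert \<Rightarrow> ('k, 'g4::real_inner) hilbert \<Rightarrow>
     ('g1 \<Rightarrow> 'g4) \<Rightarrow> ('g3 \<Rightarrow> 'g4) \<Rightarrow> ('g1 \<Rightarrow> 'g2) \<Rightarrow> ('g1 \<Rightarrow> 'g4) set" where
  "Y_set r G1 G2 G3 G4 N D E =
     (let K = proj G4 (closure (range D)) \<circ> N \<circ> proj G1 (orth G1 (E -` {0}))
      in {Y \<in> finite_rank_ops r G1 G4.
            range Y \<subseteq> dom (mp_inverse G3 G4 D) \<and>
            (\<forall>Z\<in>finite_rank_ops r G1 G4.
               hs_norm G1 (\<lambda>x. K x - Y x) \<le> hs_norm G1 (\<lambda>x. K x - Z x))})"

text \<open>\<open>X\<close> attains the minimum of \<open>\<parallel>N - D X E\<parallel>\<close> over \<open>\<X>\<^sub>r(D,E)\<close>.\<close>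

definition is_solution ::
  "nat \<Rightarrow> ('k::real_or_complex, 'g1::real_inner) hilbert \<Rightarrow> ('k, 'g2::real_inner) hilbert \<Rightarrow>
     ('k, 'g3::real_inner) hilbert \<Rightarrow> ('k, 'g4::real_inner) hilbert \<Rightarrow>
     ('g1 \<Rightarrow> 'g4) \<Rightarrow> ('g3 \<Rightarrow> 'g4) \<Rightarrow> ('g1 \<Rightarrow> 'g2) \<Rightarrow> ('g2 \<rightharpoonup> 'g3) \<Rightarrow> bool" where
  "is_solution r G1 G2 G3 G4 N D E X \<longleftrightarrow>
     X \<in> X_set r G1 G2 G3 G4 D E \<and>
     (\<forall>X'\<in>X_set r G1 G2 G3 G4 D E.
        hs_norm G1 (\<lambda>x. N x - sandwich D X E x) \<le> hs_norm G1 (\<lambda>x. N x - sandwich D X' E x))"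

end

theory Submission
  imports Defs
begin

text \<open>
  Let \<open>P\<close>, \<open>Q\<close> be the orthogonal projectors onto the closure of \<open>ran D\<close> and onto \<open>(ker E)\<^sup>\<bottom>\<close>, and
  \<open>K = P N Q\<close>. The Hilbert--Schmidt norm is invariant under adjoints, and every Hilbert--Schmidt
  operator \<open>T\<close> satisfies the Pythagorean identity
  \<open>\<parallel>T\<parallel>\<^sup>2 = \<parallel>P T Q\<parallel>\<^sup>2 + \<parallel>T - P T\<parallel>\<^sup>2 + \<parallel>P T - P T Q\<parallel>\<^sup>2\<close>. Applied to \<open>T = K - Y\<close> it shows that a best
  approximation \<open>Y\<close> of rank at most \<open>r\<close> of \<open>K\<close> satisfies \<open>Y = P Y Q\<close>, since otherwise \<open>P Y Q\<close> would
  be better; hence \<open>D (D\<^sup>\<dagger> Y E\<^sup>\<dagger>) E = Y\<close>. Applied to \<open>T = N - D X E\<close> it shows that \<open>\<parallel>N - D X E\<parallel>\<^sup>2\<close> and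
  \<open>\<parallel>K - D X E\<parallel>\<^sup>2\<close> differ by a constant, so \<open>D\<^sup>\<dagger> Y E\<^sup>\<dagger>\<close> is a solution. Neither step needs a singular
  value decomposition.

  Passing to adjoints, \<open>Y\<close> inherits optimality from \<open>Y\<^sup>*\<close>, so membership of \<open>Y\<close> in \<open>\<Y>\<^sub>r(M,B,C)\<close>
  reduces to \<open>ran Y \<subseteq> dom B\<^sup>\<dagger>\<close>. If this holds, expand \<open>Y\<^sup>*\<close> in an orthonormal basis \<open>f\<close> of its range
  and put \<open>w\<^sub>f = B\<^sup>\<dagger> Y f\<close> and \<open>g\<^sub>f = (C\<^sup>*)\<^sup>\<dagger> f\<close>: then \<open>X\<^sup>a = \<Sum>\<^sub>f \<langle>\<sqdot>, w\<^sub>f\<rangle> g\<^sub>f\<close> and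
  \<open>X\<^sup>d = \<Sum>\<^sub>f \<langle>\<sqdot>, g\<^sub>f\<rangle> w\<^sub>f\<close>, which are bounded and mutually adjoint. Conversely, if \<open>X\<^sup>a\<close> is bounded, then
  \<open>\<langle>z, Y x\<rangle> = \<langle>X\<^sup>a B\<^sup>* z, C x\<rangle>\<close> is a bounded functional of \<open>B\<^sup>* z\<close>, and its Riesz representative is
  mapped to \<open>Y x\<close> by \<open>B\<close>.
\<close>

section \<open>Riesz representation and orthogonal projectors\<close>

text \<open>Riesz representation by the direct method: a minimizing sequence of
  \<open>J u = u \<bullet> u - 2 * \<psi> u\<close> is Cauchy, and its limit represents
  \<open>\<psi>\<close>. As \<open>V\<close> need not be closed, the limit is only known to lie in
  \<open>closure V\<close>; this lets \<open>V\<close> be the domain of an unbounded operator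
  later.\<close>

lemma minimizer_subspace_functional:
  fixes V :: "'a::{real_inner,complete_space} set"
  assumes V: "0 \<in> V" "\<And>x y. x \<in> V \<Longrightarrow> y \<in> V \<Longrightarrow> x + y \<in> V" "\<And>a x. x \<in> V \<Longrightarrow> a *\<^sub>R x \<in> V"
    and add: "\<And>x y. x \<in> V \<Longrightarrow> y \<in> V \<Longrightarrow> \<psi> (x + y) = \<psi> x + \<psi> y"
    and scale: "\<And>a x. x \<in> V \<Longrightarrow> \<psi> (a *\<^sub>R x) = a * \<psi> x"
    and bound: "\<And>x. x \<in> V \<Longrightarrow> \<bar>\<psi> x\<bar> \<le> c * norm x"
  shows "\<exists>w\<in>closure V. \<forall>u\<in>V. \<psi> u = u \<bullet> w"
proof -
  define J where "J u = u \<bullet> u - 2 * \<psi> u" for u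
  define m where "m = Inf (J ` V)"
  \<comment> \<open>Completing the square: \<open>J u\<close> is at least |u|^2 - 2 c |u|, hence at
    least - c^2.\<close>
  have Jlow: "- c\<^sup>2 \<le> J u" if "u \<in> V" for u
  proof -
    have "\<psi> u \<le> c * norm u" using bound[OF that] by simp
    moreover have "0 \<le> (norm u - c)\<^sup>2" by simp
    ultimately show ?thesis
      by (simp add: J_def power2_diff power2_norm_eq_inner mult.commute)
  qed
  have bdd: "bdd_below (J ` V)" using Jlow by (intro bdd_belowI2)
  have mle: "m \<le> J u" if "u \<in> V" for u
    unfolding m_def using bdd that by (simp add: cINF_lower)
  have "\<exists>u\<in>V. J u < m + inverse (Suc n)" for n
  proof -
    have "Inf (J ` V) < m + inverse (Suc n)" by (simp add: m_def)
    then show ?thesis using cInf_less_iff[OF _ bdd] V(1) by auto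
  qed
  then obtain u where uV: "\<And>n. u n \<in> V" and uJ: "\<And>n. J (u n) < m + inverse (Suc n)"
    by metis
  \<comment> \<open>The parallelogram law turns |x - y|^2 into 2 J x + 2 J y minus four times
    \<open>J\<close> at the midpoint, and the midpoint lies in \<open>V\<close>.\<close>
  have par: "(norm (x - y))\<^sup>2 \<le> 2 * (J x + J y - 2 * m)" if "x \<in> V" "y \<in> V" for x y
  proof -
    have "m \<le> J ((1/2) *\<^sub>R (x + y))" using V that mle by blast
    moreover have "\<psi> ((1/2) *\<^sub>R (x + y)) = (\<psi> x + \<psi> y) / 2"
      using V that by (simp add: scale add)
    ultimately show ?thesis
      unfolding J_def power2_norm_eq_inner
      by (simp add: inner_add_left inner_add_right inner_diff_left inner_diff_right
          inner_commute[of y x] field_simps)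
  qed
  have "Cauchy u"
  proof (rule CauchyI)
    fix e :: real assume e: "0 < e"
    obtain N where N: "inverse (real (Suc N)) < e\<^sup>2 / 4"
      using reals_Archimedean[of "e\<^sup>2 / 4"] e by auto
    have "norm (u i - u j) < e" if "i \<ge> N" "j \<ge> N" for i j
    proof -
      have "inverse (real (Suc i)) \<le> inverse (real (Suc N))"
        "inverse (real (Suc j)) \<le> inverse (real (Suc N))"
        using that by (auto intro!: le_imp_inverse_le)
      then have "J (u i) < m + e\<^sup>2 / 4" "J (u j) < m + e\<^sup>2 / 4"
        using uJ[of i] uJ[of j] N by linarith+
      then have "(norm (u i - u j))\<^sup>2 < e\<^sup>2"
        using par[OF uV uV, of i j] by (simp add: field_simps)
      then show ?thesis using e by (simp add: power_less_imp_less_base)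
    qed
    then show "\<exists>M. \<forall>m\<ge>M. \<forall>n\<ge>M. norm (u m - u n) < e" by blast
  qed
  then obtain w where w: "u \<longlonglongrightarrow> w" using Cauchy_convergent convergent_def by blast
  have wV: "w \<in> closure V" using w uV closure_sequential by blast
  have "\<psi> v = v \<bullet> w" if v: "v \<in> V" for v
  proof -
    \<comment> \<open>First variation in the direction \<open>v\<close>. Since \<open>w\<close> may
      lie outside \<open>V\<close>, the inequality is proved at each \<open>u n\<close> and then
      passed to the limit.\<close>
    have quad: "0 \<le> 2 * t * (w \<bullet> v - \<psi> v) + t\<^sup>2 * (v \<bullet> v)" for t
    proof -
      have ge: "- inverse (real (Suc n)) \<le> 2 * t * (u n \<bullet> v - \<psi> v) + t\<^sup>2 * (v \<bullet> v)" for n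
      proof -
        have "J (u n + t *\<^sub>R v) = J (u n) + 2 * t * (u n \<bullet> v - \<psi> v) + t\<^sup>2 * (v \<bullet> v)"
          unfolding J_def using V uV v
          by (simp add: add scale inner_add_left inner_add_right inner_commute algebra_simps
              power2_eq_square)
        moreover have "m \<le> J (u n + t *\<^sub>R v)" using V uV v mle by blast
        ultimately show ?thesis using uJ[of n] by linarith
      qed
      have l1: "(\<lambda>n. - inverse (real (Suc n))) \<longlonglongrightarrow> 0"
        using tendsto_minus[OF LIMSEQ_inverse_real_of_nat] by simp
      have l2: "(\<lambda>n. 2 * t * (u n \<bullet> v - \<psi> v) + t\<^sup>2 * (v \<bullet> v))
          \<longlonglongrightarrow> 2 * t * (w \<bullet> v - \<psi> v) + t\<^sup>2 * (v \<bullet> v)"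
        by (intro tendsto_intros w)
      show ?thesis using LIMSEQ_le[OF l1 l2] ge by blast
    qed
    define d where "d = w \<bullet> v - \<psi> v"
    define q where "q = v \<bullet> v"
    have q: "q \<ge> 0" by (simp add: q_def)
    \<comment> \<open>The choice t = - d / (q + 1) makes the quadratic equal to - d^2 (q + 2) / (q +
      1)^2; the summand 1 excludes division by zero.\<close>
    have "0 \<le> 2 * (- d / (q + 1)) * d + (- d / (q + 1))\<^sup>2 * q"
      using quad[of "- d / (q + 1)"] by (simp add: d_def q_def)
    then have "0 \<le> (2 * (- d / (q + 1)) * d + (- d / (q + 1))\<^sup>2 * q) * (q + 1)\<^sup>2"
      using q by simp
    also have "\<dots> = 2 * (- d / (q + 1) * (q + 1)) * d * (q + 1) + (- d / (q + 1) * (q + 1))\<^sup>2 * q"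
      by (simp only: power2_eq_square) algebra
    also have "- d / (q + 1) * (q + 1) = - d" using q by simp
    finally have "d\<^sup>2 * (q + 2) \<le> 0"
      by (simp add: power2_eq_square algebra_simps)
    then have "d = 0" using q
      by (smt (verit, ccfv_SIG) mult_pos_pos zero_less_power2)
    then show ?thesis by (simp add: d_def inner_commute)
  qed
  then show ?thesis using wV by blast
qed

section \<open>Conjugation and real part in the scalar field\<close>

lemma kcnj_0 [simp]: "kcnj (0::'a::real_or_complex) = 0"
  using kcnj_add[of 0 "0::'a"] by simp

lemma norm_kcnj [simp]:
  fixes x :: "'a::real_or_complex"
  shows "norm (kcnj x) = norm x"
proof (cases "x = 0")
  case False
  have "norm x * norm (kcnj x) = norm x * norm x"
    using arg_cong[OF mult_kcnj[of x], of norm] by (simp add: norm_mult power2_eq_square)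
  then show ?thesis using False by simp
qed simp

lemma kre_eqI:
  fixes x :: "'a::real_or_complex"
  assumes "x + kcnj x = (2 * a) *\<^sub>R 1"
  shows "kre x = a"
proof -
  have "kre x *\<^sub>R 1 = ((2 * a) *\<^sub>R 1) / (2::'a)" by (simp add: kre_scaleR_one assms)
  also have "\<dots> = a *\<^sub>R 1"
    by (simp add: scaleR_conv_of_real)
  finally show ?thesis by (metis scaleR_cancel_right zero_neq_one)
qed

lemma kre_0 [simp]: "kre (0::'a::real_or_complex) = 0"
  by (rule kre_eqI) simp

lemma kre_scaleR_one' [simp]: "kre (a *\<^sub>R (1::'a::real_or_complex)) = a"
  by (rule kre_eqI) (simp add: kcnj_scaleR_one scaleR_2[symmetric])

lemma kre_add:
  fixes x y :: "'a::real_or_complex"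
  shows "kre (x + y) = kre x + kre y"
proof -
  have "kre (x + y) *\<^sub>R (1::'a) = (kre x + kre y) *\<^sub>R 1"
    by (simp add: kre_scaleR_one scaleR_add_left kcnj_add add_divide_distrib algebra_simps)
  then show ?thesis by (metis scaleR_cancel_right zero_neq_one)
qed

lemma kre_minus:
  fixes x :: "'a::real_or_complex"
  shows "kre (- x) = - kre x"
  using kre_add[of x "- x"] by simp

lemma kre_diff:
  fixes x y :: "'a::real_or_complex"
  shows "kre (x - y) = kre x - kre y"
  using kre_add[of x "- y"] by (simp add: kre_minus)

lemma kre_mult_kcnj:
  fixes x :: "'a::real_or_complex"
  shows "kre (x * kcnj x) = (norm x)\<^sup>2"
  by (simp add: mult_kcnj)

lemma add_kcnj:
  fixes x :: "'a::real_or_complex"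
  shows "x + kcnj x = (2 * kre x) *\<^sub>R 1"
proof -
  have "(2 * kre x) *\<^sub>R (1::'a) = 2 *\<^sub>R ((x + kcnj x) / 2)"
    by (simp only: kre_scaleR_one[symmetric] scaleR_scaleR)
  also have "\<dots> = x + kcnj x" by (simp add: scaleR_conv_of_real)
  finally show ?thesis by simp
qed

lemma kre_scaleR:
  fixes x :: "'a::real_or_complex"
  shows "kre (a *\<^sub>R x) = a * kre x"
proof (rule kre_eqI)
  have "kcnj (a *\<^sub>R x) = a *\<^sub>R kcnj x"
    using kcnj_mult[of "a *\<^sub>R 1" x] by (simp add: kcnj_scaleR_one)
  then have "a *\<^sub>R x + kcnj (a *\<^sub>R x) = a *\<^sub>R (x + kcnj x)"
    by (simp only: scaleR_add_right)
  also have "\<dots> = (2 * (a * kre x)) *\<^sub>R 1"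
    by (simp only: add_kcnj scaleR_scaleR mult_ac)
  finally show "a *\<^sub>R x + kcnj (a *\<^sub>R x) = (2 * (a * kre x)) *\<^sub>R 1" .
qed

lemma kre_le_norm:
  fixes x :: "'a::real_or_complex"
  shows "\<bar>kre x\<bar> \<le> norm x"
proof -
  have "\<bar>kre x\<bar> = norm (kre x *\<^sub>R (1::'a))" by simp
  also have "\<dots> = norm (x + kcnj x) / 2" by (simp only: kre_scaleR_one norm_divide norm_numeral)
  also have "\<dots> \<le> norm x" using norm_triangle_ineq[of x "kcnj x"] by simp
  finally show ?thesis .
qed

section \<open>The scalar-valued inner product, Cauchy-Schwarz and Riesz\<close>

context hilbert_space
begin

lemma kinner_add_right: "kinner G x (y + z) = kinner G x y + kinner G x z"
  by (metis kinner_commute kinner_add_left kcnj_add)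

lemma kinner_scale_right: "kinner G x (kscale G c y) = kcnj c * kinner G x y"
  by (metis kinner_commute kinner_scale_left kcnj_mult)

lemma kinner_zero [simp]: "kinner G 0 x = 0" "kinner G x 0 = 0"
  using kinner_add_left[of 0 0 x] kinner_add_right[of x 0 0] by simp_all

lemma kinner_minus_left: "kinner G (- x) y = - kinner G x y"
  using kinner_add_left[of x "- x" y] by (simp add: eq_neg_iff_add_eq_0 add.commute)

lemma kinner_minus_right: "kinner G x (- y) = - kinner G x y"
  using kinner_add_right[of x y "- y"] by (simp add: eq_neg_iff_add_eq_0 add.commute)

lemma kinner_diff_left: "kinner G (x - y) z = kinner G x z - kinner G y z"
  using kinner_add_left[of x "- y" z] by (simp add: kinner_minus_left)

lemma kinner_diff_right: "kinner G x (y - z) = kinner G x y - kinner G x z"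
  using kinner_add_right[of x y "- z"] by (simp add: kinner_minus_right)

lemma kinner_sum_left: "kinner G (\<Sum>i\<in>I. f i) y = (\<Sum>i\<in>I. kinner G (f i) y)"
  by (induction I rule: infinite_finite_induct) (simp_all add: kinner_add_left)

lemma kinner_sum_right: "kinner G y (\<Sum>i\<in>I. f i) = (\<Sum>i\<in>I. kinner G y (f i))"
  by (induction I rule: infinite_finite_induct) (simp_all add: kinner_add_right)

lemmas kinner_simps = kinner_add_left kinner_add_right kinner_diff_left kinner_diff_right
  kinner_minus_left kinner_minus_right kinner_scale_left kinner_scale_right

lemma kinner_eq_0_commute: "kinner G x y = 0 \<longleftrightarrow> kinner G y x = 0"
  by (metis kinner_commute kcnj_0)

lemma kinner_self_eq_0 [simp]: "kinner G x x = 0 \<longleftrightarrow> x = 0"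
  by (metis kre_kinner kre_0 inner_eq_zero_iff kinner_zero(1))

lemma kinner_self: "kinner G x x = (norm x)\<^sup>2 *\<^sub>R 1"
proof -
  have "(x \<bullet> x) *\<^sub>R 1 = kinner G x x"
    using kre_scaleR_one[of "kinner G x x"] kinner_commute[of x x] by (simp add: kre_kinner)
  then show ?thesis by (simp add: power2_norm_eq_inner)
qed

lemma kinner_eqI_left: "(\<And>z. kinner G x z = kinner G y z) \<Longrightarrow> x = y"
  by (metis kinner_diff_left kinner_self_eq_0 right_minus_eq)

lemma kinner_eqI_right: "(\<And>z. kinner G z x = kinner G z y) \<Longrightarrow> x = y"
  by (metis kinner_diff_right kinner_self_eq_0 right_minus_eq)

lemma norm_kscale [simp]: "norm (kscale G c x) = norm c * norm x"
proof -
  have "kinner G (kscale G c x) (kscale G c x) = c * kcnj c * kinner G x x"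
    by (simp only: kinner_scale_left kinner_scale_right mult_ac)
  then have "(norm (kscale G c x))\<^sup>2 *\<^sub>R 1 = ((norm c * norm x)\<^sup>2) *\<^sub>R (1::'k)"
    by (simp add: kinner_self mult_kcnj power_mult_distrib mult.commute)
  then have "(norm (kscale G c x))\<^sup>2 = (norm c * norm x)\<^sup>2"
    by (metis scaleR_cancel_right zero_neq_one)
  then show ?thesis by simp
qed

text \<open>Reduction to the real Cauchy-Schwarz inequality: scaling \<open>y\<close> by a = <x, y>
  makes the inner product with \<open>x\<close> equal to |a|^2, which its real part captures
  fully.\<close>

lemma norm_kinner_le: "norm (kinner G x y) \<le> norm x * norm y"
proof -
  define a where "a = kinner G x y"
  have "(norm a)\<^sup>2 = x \<bullet> kscale G a y"
    by (simp add: kre_kinner[symmetric] kinner_simps a_def[symmetric] mult.commute[of "kcnj a"]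
        kre_mult_kcnj)
  also have "\<dots> \<le> norm x * (norm a * norm y)"
    using norm_cauchy_schwarz[of x "kscale G a y"] by simp
  finally have "norm a * norm a \<le> norm a * (norm x * norm y)"
    by (simp add: power2_eq_square mult_ac)
  then have "a \<noteq> 0 \<Longrightarrow> norm a \<le> norm x * norm y"
    by (simp add: mult_le_cancel_left_pos)
  then show ?thesis unfolding a_def[symmetric]
    by (cases "a = 0") (auto intro: mult_nonneg_nonneg)
qed

lemma bounded_linear_kinner_left: "bounded_linear (\<lambda>x. kinner G x y)"
proof (rule bounded_linear_intro)
  show "kinner G (x + x') y = kinner G x y + kinner G x' y" for x x'
    by (rule kinner_add_left)
  show "kinner G (r *\<^sub>R x) y = r *\<^sub>R kinner G x y" for r x
    by (metis kinner_scale_left kscale_of_real scaleR_conv_of_real)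
  show "norm (kinner G x y) \<le> norm x * norm y" for x
    by (rule norm_kinner_le)
qed

lemma continuous_on_kinner_left: "continuous_on S (\<lambda>x. kinner G x y)"
  by (rule linear_continuous_on[OF bounded_linear_kinner_left])

lemma scaleR_subspace: "subspace V \<Longrightarrow> x \<in> V \<Longrightarrow> a *\<^sub>R x \<in> V"
  by (metis kscale_of_real subspace_scale)

text \<open>The real version represents the real part of \<open>\<phi>\<close>. For the defect
  \<open>a\<close> at \<open>u\<close>, testing with \<open>kscale G (kcnj a) u\<close> shows that
  |a|^2 has real part 0, so the full scalar values agree.\<close>

lemma riesz:
  assumes V: "subspace V"
    and add: "\<And>x y. x \<in> V \<Longrightarrow> y \<in> V \<Longrightarrow> \<phi> (x + y) = \<phi> x + \<phi> y"
    and scale: "\<And>a x. x \<in> V \<Longrightarrow> \<phi> (kscale G a x) = a * \<phi> x"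
    and bound: "\<And>x. x \<in> V \<Longrightarrow> norm (\<phi> x) \<le> c * norm x"
  shows "\<exists>w\<in>closure V. \<forall>u\<in>V. \<phi> u = kinner G u w"
proof -
  have "\<exists>w\<in>closure V. \<forall>u\<in>V. kre (\<phi> u) = u \<bullet> w"
  proof (rule minimizer_subspace_functional)
    show "kre (\<phi> (a *\<^sub>R x)) = a * kre (\<phi> x)" if "x \<in> V" for a x
      using scale[OF that, of "of_real a"]
      by (simp add: kscale_of_real scaleR_conv_of_real[symmetric] kre_scaleR)
    show "\<bar>kre (\<phi> x)\<bar> \<le> c * norm x" if "x \<in> V" for x
      using bound[OF that] kre_le_norm[of "\<phi> x"] by linarith
  qed (use V in \<open>simp_all add: add kre_add subspace_0 subspace_add scaleR_subspace\<close>)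
  then obtain w where w: "w \<in> closure V" and eq: "\<And>u. u \<in> V \<Longrightarrow> kre (\<phi> u) = u \<bullet> w" by blast
  have "\<phi> u = kinner G u w" if u: "u \<in> V" for u
  proof -
    define a where "a = \<phi> u - kinner G u w"
    have "kre (kcnj a * \<phi> u) = kre (kcnj a * kinner G u w)"
      using eq[OF subspace_scale[OF V u, of "kcnj a"]] u
      by (simp add: scale kre_kinner[symmetric] kinner_scale_left)
    then have "kre (a * kcnj a) = 0"
      by (simp add: a_def kre_diff[symmetric] left_diff_distrib right_diff_distrib mult.commute)
         (simp add: algebra_simps kre_diff kre_add)
    then show ?thesis by (simp add: kre_mult_kcnj a_def)
  qed
  then show ?thesis using w by blast
qed

section \<open>Orthogonal complements and projectors\<close>

lemma subspace_orth: "subspace (orth G S)"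
  by (rule subspaceI) (auto simp: orth_def kinner_simps)

lemma closed_orth: "closed (orth G S)"
proof -
  have "orth G S = (\<Inter>s\<in>S. {x. kinner G x s = 0})" by (auto simp: orth_def)
  also have "closed \<dots>"
    by (intro closed_INT ballI closed_Collect_eq continuous_on_kinner_left continuous_on_const)
  finally show ?thesis .
qed

lemma orth_antimono: "S \<subseteq> T \<Longrightarrow> orth G T \<subseteq> orth G S"
  by (auto simp: orth_def)

lemma subset_orth_orth: "S \<subseteq> orth G (orth G S)"
  by (auto simp: orth_def kinner_eq_0_commute)

lemma orth_orth_orth [simp]: "orth G (orth G (orth G S)) = orth G S"
  using subset_orth_orth orth_antimono by blast

lemma orth_Int: "x \<in> orth G S \<Longrightarrow> x \<in> S \<Longrightarrow> x = 0"
  by (auto simp: orth_def)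

text \<open>The Riesz representative of the functional <., x> on \<open>V\<close> is the projection
  of \<open>x\<close> onto the closure.\<close>

lemma subspace_decomp:
  assumes "subspace V"
  obtains w where "w \<in> closure V" "x - w \<in> orth G V"
proof -
  have "\<exists>w\<in>closure V. \<forall>u\<in>V. kinner G u x = kinner G u w"
    by (rule riesz[OF assms, where c="norm x"])
       (simp_all add: kinner_simps norm_kinner_le mult.commute[of "norm x"])
  then show ?thesis
    using that by (auto simp: orth_def kinner_diff_left) (metis kinner_commute)
qed

lemma orth_orth_subspace:
  assumes "subspace V"
  shows "orth G (orth G V) = closure V"
proof
  show cl: "closure V \<subseteq> orth G (orth G V)"
    by (simp add: closure_minimal closed_orth subset_orth_orth)
  show "orth G (orth G V) \<subseteq> closure V"
  proof
    fix x assume x: "x \<in> orth G (orth G V)"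
    obtain w where w: "w \<in> closure V" "x - w \<in> orth G V" using subspace_decomp[OF assms] .
    have "x - w \<in> orth G (orth G V)" using x w cl subspace_orth subspace_diff by blast
    then show "x \<in> closure V" using orth_Int w by fastforce
  qed
qed

lemma closure_orth [simp]: "closure (orth G S) = orth G S"
  by (simp add: closed_orth closure_closed)

text \<open>Projectors are studied only onto sets of the form \<open>orth G S\<close>, which are
  closed subspaces automatically; kernels and closures of ranges are later brought into this
  form.\<close>

lemma proj_unique:
  assumes "v \<in> orth G S" "x - v \<in> orth G (orth G S)"
  shows "proj G (orth G S) x = v"
  unfolding proj_def
proof (rule the_equality)
  fix v' assume v': "v' \<in> orth G S \<and> x - v' \<in> orth G (orth G S)"
  then have "(x - v') - (x - v) \<in> orth G (orth G S)"
    using assms subspace_orth subspace_diff by blast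
  moreover have "v - v' \<in> orth G S" using assms v' subspace_orth subspace_diff by blast
  ultimately show "v' = v" using orth_Int by fastforce
qed (use assms in blast)

lemma proj_orth:
  "proj G (orth G S) x \<in> orth G S" "x - proj G (orth G S) x \<in> orth G (orth G S)"
proof -
  obtain v where v: "v \<in> orth G S" "x - v \<in> orth G (orth G S)"
    using subspace_decomp[OF subspace_orth[of S]] by auto
  show "proj G (orth G S) x \<in> orth G S" "x - proj G (orth G S) x \<in> orth G (orth G S)"
    using v proj_unique[OF v] by simp_all
qed

lemma proj_id: "v \<in> orth G S \<Longrightarrow> proj G (orth G S) v = v"
  by (rule proj_unique) (simp_all add: subspace_0 subspace_orth)

lemma proj_add: "proj G (orth G S) (x + y) = proj G (orth G S) x + proj G (orth G S) y"
proof (rule proj_unique)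
  show "x + y - (proj G (orth G S) x + proj G (orth G S) y) \<in> orth G (orth G S)"
    using subspace_add[OF subspace_orth proj_orth(2)[of x S] proj_orth(2)[of y S]]
    by (simp add: algebra_simps)
qed (simp add: subspace_add subspace_orth proj_orth)

lemma proj_scale: "proj G (orth G S) (kscale G c x) = kscale G c (proj G (orth G S) x)"
proof (rule proj_unique)
  show "kscale G c x - kscale G c (proj G (orth G S) x) \<in> orth G (orth G S)"
    using subspace_scale[OF subspace_orth proj_orth(2)[of x S], of c]
    by (simp add: scale_right_diff_distrib)
qed (simp add: subspace_scale subspace_orth proj_orth)

lemma kinner_proj: "kinner G (proj G (orth G S) x) y = kinner G x (proj G (orth G S) y)"
proof -
  have "kinner G (proj G (orth G S) x) (y - proj G (orth G S) y) = 0"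
    using proj_orth(1)[of S x] proj_orth(2)[where x=y and S=S] kinner_eq_0_commute
    by (auto simp: orth_def)
  moreover have "kinner G (x - proj G (orth G S) x) (proj G (orth G S) y) = 0"
    using proj_orth(1)[of S y] proj_orth(2)[where x=x and S=S]
    by (auto simp: orth_def)
  ultimately show ?thesis by (simp add: kinner_simps)
qed

lemma kinner_eq_0_imp_pythagoras:
  "kinner G x y = 0 \<Longrightarrow> (norm (x + y))\<^sup>2 = (norm x)\<^sup>2 + (norm y)\<^sup>2"
  using kre_kinner[of x y] by (simp add: power2_norm_eq_inner inner_add_left inner_add_right inner_commute)

lemma norm_proj_pythagoras:
  "(norm x)\<^sup>2 = (norm (proj G (orth G S) x))\<^sup>2 + (norm (x - proj G (orth G S) x))\<^sup>2"
proof -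
  have "kinner G (proj G (orth G S) x) (x - proj G (orth G S) x) = 0"
    using proj_orth(1)[of S x] proj_orth(2)[where x=x and S=S] kinner_eq_0_commute
    by (auto simp: orth_def)
  from kinner_eq_0_imp_pythagoras[OF this] show ?thesis by simp
qed

lemma norm_proj_le: "norm (proj G (orth G S) x) \<le> norm x"
  using norm_proj_pythagoras[of x S] by (simp add: power2_le_imp_le)

end

section \<open>Orthonormal sets\<close>

definition orthonormal :: "('k::real_or_complex, 'h::real_inner) hilbert \<Rightarrow> 'h set \<Rightarrow> bool" where
  "orthonormal G E \<longleftrightarrow> (\<forall>e\<in>E. \<forall>f\<in>E. kinner G e f = (if e = f then 1 else 0))"

lemma orthonormal_subset: "orthonormal G E \<Longrightarrow> F \<subseteq> E \<Longrightarrow> orthonormal G F"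
  unfolding orthonormal_def by (meson subsetD)

context hilbert_space
begin

lemma is_onb_iff: "is_onb G E \<longleftrightarrow> orthonormal G E \<and> closure (span E) = UNIV"
  by (simp add: is_onb_def orthonormal_def)

lemma orth_span: "orth G (span S) = orth G S"
proof
  show "orth G S \<subseteq> orth G (span S)"
  proof
    fix x assume x: "x \<in> orth G S"
    have "kinner G x s = 0" if "s \<in> span S" for s
      using that
    proof (induction rule: span_induct)
      case base
      show ?case by (rule subspaceI) (auto simp: kinner_simps)
    qed (use x in \<open>auto simp: orth_def\<close>)
    then show "x \<in> orth G (span S)" by (simp add: orth_def)
  qed
qed (auto simp: orth_def span_base)

lemma norm_orthonormal: "orthonormal G F \<Longrightarrow> e \<in> F \<Longrightarrow> norm e = 1"
  using kre_kinner[of e e] kre_scaleR_one'[of 1, where 'a='k]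
  by (simp add: orthonormal_def norm_eq_1)

text \<open>The extension step shared by Gram-Schmidt and by the maximality argument for orthonormal
  bases.\<close>

lemma orthonormal_insert_normalized:
  assumes F: "orthonormal G F" and z: "z \<in> orth G F" "z \<noteq> 0"
  shows "orthonormal G (insert (kscale G (of_real (inverse (norm z))) z) F)"
proof -
  define f where "f = kscale G (of_real (inverse (norm z))) z"
  have fF: "kinner G f e = 0 \<and> kinner G e f = 0" if "e \<in> F" for e
    using that z(1) kinner_eq_0_commute unfolding f_def
    by (auto simp: orth_def kinner_simps)
  have ff: "kinner G f f = 1"
    using z(2) kinner_self[of f] by (simp add: f_def norm_inverse)
  show ?thesis
    unfolding f_def[symmetric] using F fF ff by (auto simp: orthonormal_def)
qed

section \<open>Finite Fourier sums, Bessel's identity and Parseval's identity\<close>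

lemma norm_orthonormal_sum:
  assumes "finite F" "orthonormal G F"
  shows "(norm (\<Sum>e\<in>F. kscale G (c e) e))\<^sup>2 = (\<Sum>e\<in>F. (norm (c e))\<^sup>2)"
  using assms
proof (induction F rule: finite_induct)
  case (insert f F)
  have F: "orthonormal G F" using insert.prems by (rule orthonormal_subset) auto
  have f: "kinner G f e = 0" if "e \<in> F" for e
    using insert.prems insert.hyps(2) that by (auto simp: orthonormal_def)
  have "kinner G (kscale G (c f) f) (\<Sum>e\<in>F. kscale G (c e) e) = 0"
    by (simp add: kinner_sum_right kinner_simps f)
  moreover have "norm f = 1" using insert.prems norm_orthonormal by blast
  ultimately show ?case
    using insert.hyps insert.IH[OF F] by (simp add: kinner_eq_0_imp_pythagoras)
qed simp

text \<open>For finite orthonormal \<open>F\<close> this is the orthogonal projection onto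
  \<open>span F\<close>.\<close>

definition fourier :: "'h set \<Rightarrow> 'h \<Rightarrow> 'h" where
  "fourier F x = (\<Sum>e\<in>F. kscale G (kinner G x e) e)"

lemma fourier_in_span: "fourier F x \<in> span F"
  unfolding fourier_def by (intro span_sum span_scale span_base)

lemma fourier_residual:
  assumes "finite F" "orthonormal G F"
  shows "x - fourier F x \<in> orth G (span F)"
proof -
  have "kinner G (fourier F x) f = kinner G x f" if "f \<in> F" for f
  proof -
    have "kinner G (fourier F x) f = (\<Sum>e\<in>F. if e = f then kinner G x e else 0)"
      unfolding fourier_def kinner_sum_left
      by (rule sum.cong) (use assms(2) that in \<open>auto simp: orthonormal_def kinner_simps\<close>)
    then show ?thesis using that assms(1) by simp
  qed
  then show ?thesis by (simp add: orth_span) (simp add: orth_def kinner_simps)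
qed

lemma fourier_id:
  assumes "finite F" "orthonormal G F" "x \<in> span F"
  shows "fourier F x = x"
proof -
  have "x - fourier F x \<in> span F" using assms(3) fourier_in_span span_diff by blast
  then show ?thesis using orth_Int[OF fourier_residual[OF assms(1,2), of x]] by simp
qed

lemma bessel_identity:
  assumes "finite F" "orthonormal G F"
  shows "(norm x)\<^sup>2 = (\<Sum>e\<in>F. (norm (kinner G x e))\<^sup>2) + (norm (x - fourier F x))\<^sup>2"
proof -
  have "kinner G (fourier F x) (x - fourier F x) = 0"
    using fourier_residual[OF assms, of x] fourier_in_span kinner_eq_0_commute
    by (auto simp: orth_def)
  from kinner_eq_0_imp_pythagoras[OF this] show ?thesis
    by (simp add: fourier_def norm_orthonormal_sum[OF assms])
qed

lemma fourier_best_approximation: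
  assumes "finite F" "orthonormal G F" "y \<in> span F"
  shows "norm (x - fourier F x) \<le> norm (x - y)"
proof -
  have "fourier F x - y \<in> span F" using assms(3) fourier_in_span span_diff by blast
  then have "kinner G (x - fourier F x) (fourier F x - y) = 0"
    using fourier_residual[OF assms(1,2), of x] by (auto simp: orth_def)
  from kinner_eq_0_imp_pythagoras[OF this] show ?thesis
    by (simp add: power2_le_imp_le)
qed

text \<open>A vector of \<open>span E\<close> within \<open>sqrt \<epsilon>\<close> of
  \<open>x\<close> involves finitely many basis vectors \<open>X\<close>. For every finite
  \<open>F\<close> between \<open>X\<close> and \<open>E\<close> the Fourier sum is at least as
  close, and Bessel's identity turns this into an error below \<open>\<epsilon>\<close> for the
  partial sum.\<close>

lemma parseval:
  assumes "is_onb G E"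
  shows "((\<lambda>e. (norm (kinner G x e))\<^sup>2) has_sum (norm x)\<^sup>2) E"
  unfolding has_sum_def
proof (rule tendstoI)
  fix \<epsilon> :: real assume \<epsilon>: "0 < \<epsilon>"
  have E: "orthonormal G E" "x \<in> closure (span E)" using assms by (auto simp: is_onb_iff)
  then obtain y where y: "y \<in> span E" "dist y x < sqrt \<epsilon>"
    using \<epsilon> unfolding closure_approachable by (meson real_sqrt_gt_zero)
  obtain X c where X: "finite X" "X \<subseteq> E" "y = (\<Sum>a\<in>X. kscale G (c a) a)"
    using y(1) by (auto simp: span_explicit)
  have yX: "y \<in> span X" unfolding X(3) by (intro span_sum span_scale span_base)
  have "dist (\<Sum>e\<in>F. (norm (kinner G x e))\<^sup>2) ((norm x)\<^sup>2) < \<epsilon>"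
    if F: "finite F" "X \<subseteq> F" "F \<subseteq> E" for F
  proof -
    have oF: "orthonormal G F" using E(1) F(3) orthonormal_subset by blast
    have "norm (x - fourier F x) \<le> norm (x - y)"
      using fourier_best_approximation[OF F(1) oF] yX span_mono[OF F(2)] by blast
    also have "\<dots> < sqrt \<epsilon>" using y(2) by (simp add: dist_norm norm_minus_commute)
    finally have "(norm (x - fourier F x))\<^sup>2 < \<epsilon>"
      using \<epsilon> power_strict_mono[of _ "sqrt \<epsilon>" 2] by fastforce
    then show ?thesis
      using bessel_identity[OF F(1) oF, of x] by (simp add: dist_real_def)
  qed
  then show "\<forall>\<^sub>F F in finite_subsets_at_top E.
      dist (\<Sum>e\<in>F. (norm (kinner G x e))\<^sup>2) ((norm x)\<^sup>2) < \<epsilon>"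
    using X by (auto simp: eventually_finite_subsets_at_top)
qed

text \<open>Zorn's lemma gives a maximal orthonormal set; if its span were not dense, a normalized
  residual would extend it.\<close>

lemma ex_onb: "\<exists>E. is_onb G E"
proof -
  have "\<exists>E\<in>{E. orthonormal G E}. \<forall>X\<in>{E. orthonormal G E}. E \<subseteq> X \<longrightarrow> X = E"
  proof (rule subset_Zorn')
    fix \<C> assume C: "subset.chain {E. orthonormal G E} \<C>"
    have "kinner G e f = (if e = f then 1 else 0)" if ef: "e \<in> \<Union>\<C>" "f \<in> \<Union>\<C>" for e f
    proof -
      obtain X Z where "X \<in> \<C>" "e \<in> X" "Z \<in> \<C>" "f \<in> Z" using ef by blast
      then obtain W where "W \<in> \<C>" "e \<in> W" "f \<in> W"
        using C unfolding subset_chain_def by (metis subsetD)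
      then show ?thesis using C by (auto simp: subset_chain_def orthonormal_def)
    qed
    then show "\<Union>\<C> \<in> {E. orthonormal G E}" by (auto simp: orthonormal_def)
  qed
  then obtain E where E: "orthonormal G E"
    and max: "\<And>X. orthonormal G X \<Longrightarrow> E \<subseteq> X \<Longrightarrow> X = E" by blast
  have "x \<in> closure (span E)" for x
  proof (rule ccontr)
    assume x: "x \<notin> closure (span E)"
    obtain w where w: "w \<in> closure (span E)" "x - w \<in> orth G (span E)"
      using subspace_decomp[OF subspace_span] .
    define f where "f = kscale G (of_real (inverse (norm (x - w)))) (x - w)"
    have z: "x - w \<in> orth G E" "x - w \<noteq> 0" using w x by (auto simp: orth_span)
    have "insert f E = E"
      unfolding f_def using orthonormal_insert_normalized[OF E z] by (intro max) auto
    \<comment> \<open>Maximality puts \<open>f\<close> into \<open>E\<close>, yet \<open>f\<close>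
      is orthogonal to \<open>E\<close>.\<close>
    then have "f \<in> E" by blast
    moreover have "f \<in> orth G E"
      unfolding f_def using z(1) by (simp add: subspace_scale subspace_orth)
    ultimately have "f = 0" using orth_Int by blast
    then show False using z(2) by (simp add: f_def scale_eq_0_iff)
  qed
  then show ?thesis using E by (auto simp: is_onb_iff)
qed

section \<open>Gram-Schmidt and finite-dimensional subspaces\<close>

lemma gram_schmidt:
  "finite A \<Longrightarrow> \<exists>F. finite F \<and> card F \<le> card A \<and> orthonormal G F \<and> span F = span A"
proof (induction A rule: finite_induct)
  case empty
  show ?case by (rule exI[of _ "{}"]) (simp add: orthonormal_def)
next
  case (insert a A)
  then obtain F where F: "finite F" "card F \<le> card A" "orthonormal G F" "span F = span A" by blast
  define z where "z = a - fourier F a"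
  show ?case
  proof (cases "z = 0")
    case True
    \<comment> \<open>A vector that depends on the earlier ones is dropped, so the cardinality is
      only bounded.\<close>
    then have "a \<in> span F" using fourier_in_span[of F a] by (simp add: z_def)
    then have "span F = span (insert a A)" using F(4) by (simp add: span_redundant)
    then show ?thesis using F insert.hyps by (intro exI[of _ F]) auto
  next
    case False
    define f where "f = kscale G (of_real (inverse (norm z))) z"
    have zF: "z \<in> orth G F"
      unfolding z_def using fourier_residual[OF F(1,3)] by (simp add: orth_span)
    have on: "orthonormal G (insert f F)"
      unfolding f_def by (rule orthonormal_insert_normalized[OF F(3) zF False])
    have four: "fourier F a \<in> span (insert f F)" "fourier F a \<in> span (insert a A)"
      using fourier_in_span[of F a] F(4) span_mono[OF subset_insertI] by blast+
    have "z \<in> span (insert a A)"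
      unfolding z_def by (intro span_diff four span_base) simp
    then have f: "f \<in> span (insert a A)" unfolding f_def by (rule span_scale)
    have "z = kscale G (of_real (norm z)) f" using False by (simp add: f_def)
    then have "z \<in> span (insert f F)" by (metis span_scale span_base insertI1)
    then have a: "a \<in> span (insert f F)"
      using span_add[OF _ four(1)] by (fastforce simp: z_def)
    have "F \<subseteq> span (insert a A)" "A \<subseteq> span (insert f F)"
      using F(4) span_mono[OF subset_insertI] span_superset by blast+
    then have "span (insert f F) = span (insert a A)"
      unfolding span_eq using a f by simp
    moreover have "card (insert f F) \<le> card (insert a A)"
      using F(1,2) insert.hyps by (simp add: card_insert_if)
    ultimately show ?thesis using F(1) on by blast
  qed
qed

text \<open>\<open>dim_at_most\<close> asks for a basis of exactly \<open>V\<close>, while in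
  applications only a small set with larger span is at hand. A basis chosen inside \<open>V\<close>
  is independent in \<open>span A\<close>, so exchange bounds its size.\<close>

lemma dim_at_mostI:
  assumes "subspace V" "V \<subseteq> span A" "finite A" "card A \<le> r"
  shows "dim_at_most G r V"
proof -
  obtain C where C: "C \<subseteq> V" "independent C" "V \<subseteq> span C" by (metis basis_exists)
  have "C \<subseteq> span A" using C(1) assms(2) by blast
  then have "finite C" "card C \<le> r" using independent_span_bound[OF assms(3) C(2)] assms(4) by auto
  moreover have "span C = V" using C assms(1) by (simp add: span_minimal subset_antisym)
  ultimately show ?thesis using C(2) unfolding dim_at_most_def by blast
qed

lemma dim_at_most_orthonormal:
  assumes "dim_at_most G r V"
  obtains F where "finite F" "card F \<le> r" "orthonormal G F" "span F = V"
  using assms gram_schmidt unfolding dim_at_most_def by (metis le_trans)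

end

section \<open>Adjoint pairs and the Hilbert--Schmidt norm\<close>

locale hilbert_pair = G: hilbert_space G + H: hilbert_space H
  for G :: "('k::real_or_complex, 'g::{real_inner,complete_space}) hilbert"
    and H :: "('k, 'h::{real_inner,complete_space}) hilbert"
begin

lemma bounded_ops_iff:
  "T \<in> bounded_ops G H \<longleftrightarrow> (\<forall>x y. T (x + y) = T x + T y) \<and>
     (\<forall>c x. T (kscale G c x) = kscale H c (T x)) \<and> (\<exists>c. \<forall>x. norm (T x) \<le> c * norm x)"
  by (simp add: bounded_ops_def Vector_Spaces.linear_iff G.vector_space_axioms H.vector_space_axioms)

end

text \<open>The adjoint is a parameter instead of \<open>adj G H T\<close>. This makes the locale
  symmetric in \<open>T\<close> and \<open>S\<close>, and adjoints of composites and differences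
  stay explicit terms.\<close>

locale adjoint_ops = hilbert_pair G H
  for G :: "('k::real_or_complex, 'g::{real_inner,complete_space}) hilbert"
    and H :: "('k, 'h::{real_inner,complete_space}) hilbert" +
  fixes T :: "'g \<Rightarrow> 'h" and S :: "'h \<Rightarrow> 'g"
  assumes bounded: "T \<in> bounded_ops G H"
    and adjoint: "kinner H (T x) y = kinner G x (S y)"
begin

lemma add: "T (x + y) = T x + T y"
  and scale: "T (kscale G c x) = kscale H c (T x)"
  and ex_bound: "\<exists>c. \<forall>x. norm (T x) \<le> c * norm x"
  using bounded by (auto simp: bounded_ops_iff)

lemma zero [simp]: "T 0 = 0"
  using add[of 0 0] by simp

lemma diff: "T (x - y) = T x - T y"
  using add[of "x - y" y] by simp

lemma sum: "T (\<Sum>i\<in>I. f i) = (\<Sum>i\<in>I. T (f i))"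
  by (induction I rule: infinite_finite_induct) (simp_all add: add)

lemma ex_bound_pos: "\<exists>c\<ge>0. \<forall>x. norm (T x) \<le> c * norm x"
proof -
  obtain c where "\<forall>x. norm (T x) \<le> c * norm x" using ex_bound by blast
  then have "norm (T x) \<le> max c 0 * norm x" for x
    by (meson max.cobounded1 mult_right_mono norm_ge_zero order_trans)
  then show ?thesis by (meson max.cobounded2)
qed

lemma adjoint': "kinner G (S y) x = kinner H y (T x)"
  by (metis adjoint G.kinner_commute H.kinner_commute)

text \<open>Linearity of \<open>S\<close> follows by testing against all vectors; its bound is that
  of \<open>T\<close>, because |S y|^2 = <y, T (S y)>.\<close>

lemma flip: "adjoint_ops H G S T"
proof -
  interpret flip: hilbert_pair H G ..
  have add: "S (x + y) = S x + S y" for x y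
    by (rule G.kinner_eqI_left) (simp add: adjoint' G.kinner_add_left H.kinner_add_left)
  have scale: "S (kscale H c x) = kscale G c (S x)" for c x
    by (rule G.kinner_eqI_left) (simp add: adjoint' G.kinner_scale_left H.kinner_scale_left)
  obtain c where c: "c \<ge> 0" "\<And>x. norm (T x) \<le> c * norm x" using ex_bound_pos by blast
  have "norm (S y) \<le> c * norm y" for y
  proof (cases "S y = 0")
    case False
    have "norm (S y) * norm (S y) = norm (kinner G (S y) (S y))"
      by (simp add: G.kinner_self power2_eq_square)
    also have "\<dots> = norm (kinner H y (T (S y)))" by (simp add: adjoint')
    also have "\<dots> \<le> norm y * (c * norm (S y))"
      by (meson H.norm_kinner_le c(2) mult_left_mono norm_ge_zero order_trans)
    finally have "norm (S y) * norm (S y) \<le> norm (S y) * (c * norm y)" by (simp add: mult_ac)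
    then show ?thesis using False by (simp add: mult_le_cancel_left_pos)
  qed (use c(1) in simp)
  then show ?thesis
    by unfold_locales (auto simp: flip.bounded_ops_iff add scale adjoint')
qed

lemma adj_eq: "adj G H T = S"
  unfolding adj_def
proof (rule the_equality)
  fix S' assume "\<forall>x y. kinner H (T x) y = kinner G x (S' y)"
  then show "S' = S" by (intro ext G.kinner_eqI_right) (metis adjoint)
qed (simp add: adjoint)

lemma subspace_range: "H.subspace (range T)"
  by (rule H.subspaceI) (metis rangeI zero, metis (no_types) add rangeE rangeI, metis (no_types) scale rangeE rangeI)

lemma orth_range: "orth H (range T) = S -` {0}"
proof -
  have "(\<forall>x. kinner G (S y) x = 0) \<longleftrightarrow> S y = 0" for y
    by (metis G.kinner_self_eq_0 G.kinner_zero(1))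
  then show ?thesis by (auto simp: orth_def adjoint')
qed

end

text \<open>Riesz on the whole space supplies the values of an adjoint, and \<open>adj_eq\<close>
  identifies it with the definite description.\<close>

lemma (in hilbert_pair) adjoint_ops_adj:
  assumes "T \<in> bounded_ops G H"
  shows "adjoint_ops G H T (adj G H T)"
proof -
  have T: "T (x + y) = T x + T y" "T (kscale G c x) = kscale H c (T x)" for x y c
    using assms by (auto simp: bounded_ops_iff)
  obtain c where c: "\<And>x. norm (T x) \<le> c * norm x" using assms by (auto simp: bounded_ops_iff)
  have "\<exists>w. \<forall>x. kinner H (T x) y = kinner G x w" for y
  proof -
    have "\<exists>w\<in>closure UNIV. \<forall>x\<in>UNIV. kinner H (T x) y = kinner G x w"
    proof (rule G.riesz)
      show "norm (kinner H (T x) y) \<le> (c * norm y) * norm x" for x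
        using H.norm_kinner_le[of "T x" y] mult_right_mono[OF c[of x], of "norm y"]
        by (simp add: mult_ac)
    qed (simp_all add: T H.kinner_simps)
    then show ?thesis by blast
  qed
  then obtain S where S: "\<And>x y. kinner H (T x) y = kinner G x (S y)" by metis
  have "adjoint_ops G H T S" by unfold_locales (use assms S in auto)
  then show ?thesis by (simp add: adjoint_ops.adj_eq)
qed

lemma adjoint_ops_comp:
  assumes "adjoint_ops G H T S" "adjoint_ops H K T' S'"
  shows "adjoint_ops G K (\<lambda>x. T' (T x)) (\<lambda>y. S (S' y))"
proof -
  interpret A: adjoint_ops G H T S by fact
  interpret B: adjoint_ops H K T' S' by fact
  interpret hilbert_pair G K ..
  obtain a where a: "a \<ge> 0" "\<And>x. norm (T' x) \<le> a * norm x" using B.ex_bound_pos by blast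
  obtain b where b: "\<And>x. norm (T x) \<le> b * norm x" using A.ex_bound by blast
  have "norm (T' (T x)) \<le> (a * b) * norm x" for x
    using a(2)[of "T x"] mult_left_mono[OF b[of x] a(1)] by (simp add: mult_ac)
  then show ?thesis
    by unfold_locales
      (auto simp: bounded_ops_iff A.add B.add A.scale B.scale A.adjoint B.adjoint)
qed

lemma adjoint_ops_diff:
  assumes "adjoint_ops G H T S" "adjoint_ops G H T' S'"
  shows "adjoint_ops G H (\<lambda>x. T x - T' x) (\<lambda>y. S y - S' y)"
proof -
  interpret A: adjoint_ops G H T S by fact
  interpret B: adjoint_ops G H T' S' by fact
  obtain a where a: "\<And>x. norm (T' x) \<le> a * norm x" using B.ex_bound by blast
  obtain b where b: "\<And>x. norm (T x) \<le> b * norm x" using A.ex_bound by blast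
  have "norm (T x - T' x) \<le> (b + a) * norm x" for x
    using norm_triangle_ineq4[of "T x" "T' x"] a[of x] b[of x] by (simp add: distrib_right)
  then show ?thesis
    by unfold_locales
      (auto simp: A.bounded_ops_iff A.add B.add A.scale B.scale A.H.scale_right_diff_distrib
        A.adjoint B.adjoint A.G.kinner_diff_right A.H.kinner_diff_left)
qed

lemma (in hilbert_space) adjoint_ops_proj:
  "adjoint_ops G G (proj G (orth G V)) (proj G (orth G V))"
proof -
  interpret hilbert_pair G G ..
  show ?thesis
    by unfold_locales
      (auto simp: bounded_ops_iff proj_add proj_scale kinner_proj
        intro!: exI[of _ 1] norm_proj_le)
qed

section \<open>The Hilbert-Schmidt norm: basis independence, adjoints, ideal property\<close>

context adjoint_ops
begin

text \<open>The nonnegative double sum of |<T e, f>|^2 is evaluated in both orders: Parseval in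
  \<open>H\<close> gives |T e|^2 for the rows, Parseval in \<open>G\<close> gives |S f|^2 for the
  columns.\<close>

lemma has_sum_adjoint:
  assumes E: "is_onb G E" and F: "is_onb H F"
    and T: "((\<lambda>e. (norm (T e))\<^sup>2) has_sum s) E"
  shows "((\<lambda>f. (norm (S f))\<^sup>2) has_sum s) F"
proof -
  define u where "u = (\<lambda>(e, f). (norm (kinner H (T e) f))\<^sup>2)"
  have row: "((\<lambda>f. u (e, f)) has_sum (norm (T e))\<^sup>2) F" for e
    using H.parseval[OF F, of "T e"] by (simp add: u_def)
  have "u summable_on (E \<times> F)"
    by (rule summable_on_SigmaI[where g="\<lambda>e. (norm (T e))\<^sup>2"])
       (use row T in \<open>auto simp: summable_on_def u_def\<close>)
  then have "(u has_sum s) (E \<times> F)" by (intro has_sum_SigmaI[OF row T])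
  then have "((\<lambda>(f, e). u (e, f)) has_sum s) (F \<times> E)" by (rule has_sum_swap[THEN iffD1])
  moreover have "((\<lambda>e. (\<lambda>(f, e). u (e, f)) (f, e)) has_sum (norm (S f))\<^sup>2) E" for f
  proof -
    have "norm (kinner H (T e) f) = norm (kinner G (S f) e)" for e
      by (metis G.kinner_commute adjoint norm_kcnj)
    then show ?thesis using G.parseval[OF E, of "S f"] by (simp add: u_def)
  qed
  ultimately show ?thesis by (rule has_sum_SigmaD)
qed

text \<open>Going from the basis \<open>E0\<close> to a basis of the other space through
  \<open>S\<close> and back to an arbitrary basis shows that the sum does not depend on the basis,
  in particular not on the one chosen in \<open>hs_norm\<close>.\<close>

lemma hs_has_sum:
  assumes "T \<in> hs_ops G H" "is_onb G E"
  shows "((\<lambda>e. (norm (T e))\<^sup>2) has_sum (hs_norm G T)\<^sup>2) E"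
proof -
  obtain E0 s where E0: "is_onb G E0" "((\<lambda>e. (norm (T e))\<^sup>2) has_sum s) E0"
    using assms(1) by (auto simp: hs_ops_def summable_on_def)
  obtain F where F: "is_onb H F" using H.ex_onb by blast
  interpret flip: adjoint_ops H G S T by (rule flip)
  have all: "((\<lambda>e. (norm (T e))\<^sup>2) has_sum s) E" if "is_onb G E" for E
    by (rule flip.has_sum_adjoint[OF F that has_sum_adjoint[OF E0(1) F E0(2)]])
  have "is_onb G (SOME E. is_onb G E)" using assms(2) by (rule someI)
  then have "(\<Sum>\<^sub>\<infinity>e\<in>(SOME E. is_onb G E). (norm (T e))\<^sup>2) = s" using all infsumI by blast
  moreover have "s \<ge> 0" using E0(2) by (rule has_sum_nonneg) simp
  ultimately have "(hs_norm G T)\<^sup>2 = s" by (simp add: hs_norm_def)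
  then show ?thesis using all[OF assms(2)] by simp
qed

lemma hs_opsI:
  assumes "is_onb G E" "(\<lambda>e. (norm (T e))\<^sup>2) summable_on E"
  shows "T \<in> hs_ops G H"
  using assms bounded by (auto simp: hs_ops_def)

lemma hs_norm_nonneg: "hs_norm G T \<ge> 0"
  by (simp add: hs_norm_def infsum_nonneg)

lemma hs_norm_eqI:
  assumes "is_onb G E" "((\<lambda>e. (norm (T e))\<^sup>2) has_sum s) E"
  shows "(hs_norm G T)\<^sup>2 = s"
  using assms hs_has_sum hs_opsI has_sum_unique unfolding summable_on_def by blast

lemma hs_adjoint:
  assumes "T \<in> hs_ops G H"
  shows "S \<in> hs_ops H G" and "hs_norm H S = hs_norm G T"
proof -
  obtain E F where E: "is_onb G E" and F: "is_onb H F" using G.ex_onb H.ex_onb by blast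
  interpret flip: adjoint_ops H G S T by (rule flip)
  have s: "((\<lambda>f. (norm (S f))\<^sup>2) has_sum (hs_norm G T)\<^sup>2) F"
    by (rule has_sum_adjoint[OF E F hs_has_sum[OF assms E]])
  then show "S \<in> hs_ops H G" using flip.hs_opsI[OF F] by (auto simp: summable_on_def)
  have "(hs_norm H S)\<^sup>2 = (hs_norm G T)\<^sup>2" using flip.hs_norm_eqI[OF F s] .
  then show "hs_norm H S = hs_norm G T"
    using hs_norm_nonneg flip.hs_norm_nonneg by simp
qed

text \<open>The adjoint has norm 0 as well, so \<open>S\<close> vanishes on a basis
  \<open>F\<close>; by Parseval |T x|^2 is the sum of |<x, S f>|^2.\<close>

lemma hs_norm_eq_0:
  assumes "T \<in> hs_ops G H" "hs_norm G T = 0"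
  shows "T x = 0"
proof -
  obtain F where F: "is_onb H F" using H.ex_onb by blast
  interpret flip: adjoint_ops H G S T by (rule flip)
  have "S f = 0" if "f \<in> F" for f
    using flip.hs_has_sum[OF hs_adjoint(1)[OF assms(1)] F] hs_adjoint(2)[OF assms(1)] assms(2)
      nonneg_has_sum_le_0D[OF _ _ _ that, of "\<lambda>f. (norm (S f))\<^sup>2" 0] by simp
  then have "((\<lambda>f. (norm (kinner H (T x) f))\<^sup>2) has_sum 0) F"
    by (intro has_sum_0) (simp add: adjoint)
  then show ?thesis using H.parseval[OF F, of "T x"] has_sum_unique by fastforce
qed

lemma hs_comp_left:
  assumes "T \<in> hs_ops G H" "adjoint_ops H K A A'"
  shows "(\<lambda>x. A (T x)) \<in> hs_ops G K"
proof -
  interpret A: adjoint_ops H K A A' by fact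
  interpret AT: adjoint_ops G K "\<lambda>x. A (T x)" "\<lambda>y. S (A' y)"
    by (rule adjoint_ops_comp[OF adjoint_ops_axioms assms(2)])
  obtain E where E: "is_onb G E" using G.ex_onb by blast
  obtain c where c: "c \<ge> 0" "\<And>x. norm (A x) \<le> c * norm x" using A.ex_bound_pos by blast
  have "(\<lambda>e. c\<^sup>2 * (norm (T e))\<^sup>2) summable_on E"
    by (intro summable_on_cmult_right) (use hs_has_sum[OF assms(1) E] in \<open>auto simp: summable_on_def\<close>)
  then have "(\<lambda>e. (norm (A (T e)))\<^sup>2) summable_on E"
  proof (rule summable_on_comparison_test)
    show "(norm (A (T e)))\<^sup>2 \<le> c\<^sup>2 * (norm (T e))\<^sup>2" for e
      using power_mono[OF c(2)[of "T e"], of 2] by (simp add: power_mult_distrib)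
  qed simp
  then show ?thesis by (rule AT.hs_opsI[OF E])
qed

text \<open>The left version applied to the adjoints.\<close>

lemma hs_comp_right:
  assumes "T \<in> hs_ops G H" "adjoint_ops K G A A'"
  shows "(\<lambda>x. T (A x)) \<in> hs_ops K H"
proof -
  interpret flip: adjoint_ops H G S T by (rule flip)
  interpret TA: adjoint_ops H K "\<lambda>y. A' (S y)" "\<lambda>x. T (A x)"
    by (rule adjoint_ops.flip[OF adjoint_ops_comp[OF assms(2) adjoint_ops_axioms]])
  show ?thesis
    by (rule TA.hs_adjoint(1)[OF flip.hs_comp_left[OF hs_adjoint(1)[OF assms(1)]
          adjoint_ops.flip[OF assms(2)]]])
qed

lemma hs_diff:
  assumes "T \<in> hs_ops G H" "T' \<in> hs_ops G H" "adjoint_ops G H T' S'"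
  shows "(\<lambda>x. T x - T' x) \<in> hs_ops G H"
proof -
  interpret T': adjoint_ops G H T' S' by fact
  interpret D: adjoint_ops G H "\<lambda>x. T x - T' x" "\<lambda>y. S y - S' y"
    by (rule adjoint_ops_diff[OF adjoint_ops_axioms assms(3)])
  obtain E where E: "is_onb G E" using G.ex_onb by blast
  have "(\<lambda>e. 2 * (norm (T e))\<^sup>2 + 2 * (norm (T' e))\<^sup>2) summable_on E"
    by (intro summable_on_add summable_on_cmult_right)
       (use hs_has_sum[OF assms(1) E] T'.hs_has_sum[OF assms(2) E] in \<open>auto simp: summable_on_def\<close>)
  then have "(\<lambda>e. (norm (T e - T' e))\<^sup>2) summable_on E"
  proof (rule summable_on_comparison_test)
    \<comment> \<open>The bound exceeds the left side by |T e + T' e|^2.\<close>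
    show "(norm (T e - T' e))\<^sup>2 \<le> 2 * (norm (T e))\<^sup>2 + 2 * (norm (T' e))\<^sup>2" for e
      using zero_le_power2[of "norm (T e + T' e)"] unfolding power2_norm_eq_inner
      by (simp add: inner_simps inner_commute)
  qed simp
  then show ?thesis by (rule D.hs_opsI[OF E])
qed

section \<open>Pythagorean splittings by projectors\<close>

lemma hs_norm_split_left:
  fixes V
  defines "P \<equiv> proj H (orth H V)"
  assumes "T \<in> hs_ops G H"
  shows "(hs_norm G T)\<^sup>2 = (hs_norm G (\<lambda>x. P (T x)))\<^sup>2 + (hs_norm G (\<lambda>x. T x - P (T x)))\<^sup>2"
proof -
  have P: "adjoint_ops H H P P" unfolding P_def by (rule H.adjoint_ops_proj)
  interpret PT: adjoint_ops G H "\<lambda>x. P (T x)" "\<lambda>y. S (P y)"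
    by (rule adjoint_ops_comp[OF adjoint_ops_axioms P])
  interpret D: adjoint_ops G H "\<lambda>x. T x - P (T x)" "\<lambda>y. S y - S (P y)"
    by (rule adjoint_ops_diff[OF adjoint_ops_axioms PT.adjoint_ops_axioms])
  have hs: "(\<lambda>x. P (T x)) \<in> hs_ops G H" by (rule hs_comp_left[OF assms(2) P])
  have hs': "(\<lambda>x. T x - P (T x)) \<in> hs_ops G H"
    by (rule hs_diff[OF assms(2) hs PT.adjoint_ops_axioms])
  obtain E where E: "is_onb G E" using G.ex_onb by blast
  have "((\<lambda>e. (norm (T e))\<^sup>2) has_sum
      (hs_norm G (\<lambda>x. P (T x)))\<^sup>2 + (hs_norm G (\<lambda>x. T x - P (T x)))\<^sup>2) E"
    using has_sum_add[OF PT.hs_has_sum[OF hs E] D.hs_has_sum[OF hs' E]]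
    unfolding P_def H.norm_proj_pythagoras[of "T _" V, symmetric] .
  then show ?thesis by (rule hs_norm_eqI[OF E])
qed

text \<open>Precomposition with \<open>Q\<close> does not split |T e|^2 at each basis vector;
  passing to adjoints turns it into postcomposition, where the left version applies.\<close>

lemma hs_norm_split_right:
  fixes W
  defines "Q \<equiv> proj G (orth G W)"
  assumes "T \<in> hs_ops G H"
  shows "(hs_norm G T)\<^sup>2 = (hs_norm G (\<lambda>x. T (Q x)))\<^sup>2 + (hs_norm G (\<lambda>x. T x - T (Q x)))\<^sup>2"
proof -
  have Q: "adjoint_ops G G Q Q" unfolding Q_def by (rule G.adjoint_ops_proj)
  interpret flip: adjoint_ops H G S T by (rule flip)
  interpret QS: adjoint_ops H G "\<lambda>y. Q (S y)" "\<lambda>x. T (Q x)"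
    by (rule adjoint_ops_comp[OF flip Q])
  interpret D: adjoint_ops H G "\<lambda>y. S y - Q (S y)" "\<lambda>x. T x - T (Q x)"
    by (rule adjoint_ops_diff[OF flip QS.adjoint_ops_axioms])
  have hs: "S \<in> hs_ops H G" by (rule hs_adjoint[OF assms(2)])
  have hs1: "(\<lambda>y. Q (S y)) \<in> hs_ops H G" by (rule flip.hs_comp_left[OF hs Q])
  have hs2: "(\<lambda>y. S y - Q (S y)) \<in> hs_ops H G"
    by (rule flip.hs_diff[OF hs hs1 QS.adjoint_ops_axioms])
  show ?thesis
    using flip.hs_norm_split_left[OF hs, of W] QS.hs_adjoint(2)[OF hs1] D.hs_adjoint(2)[OF hs2]
      hs_adjoint(2)[OF assms(2)] by (simp add: Q_def)
qed

text \<open>Left splitting of \<open>T\<close>, followed by right splitting of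
  \<open>P T\<close>.\<close>

lemma hs_norm_split:
  fixes V W
  defines "P \<equiv> proj H (orth H V)" and "Q \<equiv> proj G (orth G W)"
  assumes "T \<in> hs_ops G H"
  shows "(hs_norm G T)\<^sup>2 = (hs_norm G (\<lambda>x. P (T (Q x))))\<^sup>2
    + (hs_norm G (\<lambda>x. T x - P (T x)))\<^sup>2 + (hs_norm G (\<lambda>x. P (T x) - P (T (Q x))))\<^sup>2"
proof -
  have P: "adjoint_ops H H P P" unfolding P_def by (rule H.adjoint_ops_proj)
  interpret PT: adjoint_ops G H "\<lambda>x. P (T x)" "\<lambda>y. S (P y)"
    by (rule adjoint_ops_comp[OF adjoint_ops_axioms P])
  show ?thesis
    using hs_norm_split_left[OF assms(3), of V]
      PT.hs_norm_split_right[OF hs_comp_left[OF assms(3) P], of W]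
    by (simp add: P_def Q_def)
qed

section \<open>Finite-rank operators\<close>

lemma finite_rank_expansion:
  assumes "dim_at_most H r (range T)"
  obtains F where "finite F" "card F \<le> r" "orthonormal H F" "H.span F = range T"
    "\<And>x. T x = (\<Sum>f\<in>F. kscale H (kinner G x (S f)) f)"
    "\<And>y. S y = (\<Sum>f\<in>F. kscale G (kinner H y f) (S f))"
proof -
  obtain F where F: "finite F" "card F \<le> r" "orthonormal H F" "H.span F = range T"
    using H.dim_at_most_orthonormal[OF assms] .
  have T: "T x = (\<Sum>f\<in>F. kscale H (kinner G x (S f)) f)" for x
    using H.fourier_id[OF F(1,3), of "T x"] F(4) by (simp add: H.fourier_def adjoint)
  \<comment> \<open>The dual expansion, obtained by pairing with \<open>x\<close> and inserting the
    expansion of \<open>T\<close>.\<close>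
  have S: "S y = (\<Sum>f\<in>F. kscale G (kinner H y f) (S f))" for y
  proof (rule G.kinner_eqI_right)
    fix x
    have "kinner G x (S y) = (\<Sum>f\<in>F. kinner G x (S f) * kinner H f y)"
      by (subst adjoint[symmetric], subst T)
         (simp only: H.kinner_sum_left H.kinner_scale_left)
    also have "\<dots> = kinner G x (\<Sum>f\<in>F. kscale G (kinner H y f) (S f))"
      unfolding G.kinner_sum_right G.kinner_scale_right
      by (intro sum.cong refl) (simp add: H.kinner_commute[symmetric])
    finally show "kinner G x (S y) = kinner G x (\<Sum>f\<in>F. kscale G (kinner H y f) (S f))" .
  qed
  show ?thesis by (rule that[OF F T S])
qed

text \<open>|T x|^2 is a finite sum of terms |<S f, x>|^2, each summable over a basis by
  Parseval.\<close>

lemma finite_rank_hs: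
  assumes "dim_at_most H r (range T)"
  shows "T \<in> hs_ops G H"
proof -
  obtain F where F: "finite F" "orthonormal H F"
    "\<And>x. T x = (\<Sum>f\<in>F. kscale H (kinner G x (S f)) f)"
    using finite_rank_expansion[OF assms] by metis
  obtain E where E: "is_onb G E" using G.ex_onb by blast
  have nT: "(norm (T x))\<^sup>2 = (\<Sum>f\<in>F. (norm (kinner G (S f) x))\<^sup>2)" for x
    unfolding F(3)[of x] H.norm_orthonormal_sum[OF F(1,2)]
    by (intro sum.cong refl) (metis G.kinner_commute norm_kcnj)
  have "(\<lambda>e. \<Sum>f\<in>F. (norm (kinner G (S f) e))\<^sup>2) summable_on E"
    using F(1)
  proof (induction F rule: finite_induct)
    case (insert f F)
    have "(\<lambda>e. (norm (kinner G (S f) e))\<^sup>2) summable_on E"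
      using G.parseval[OF E] by (auto simp: summable_on_def)
    then show ?case using insert by (simp add: summable_on_add)
  qed simp
  then show ?thesis by (intro hs_opsI[OF E]) (simp add: nT)
qed

text \<open>By the dual expansion, the vectors \<open>S f\<close> with \<open>f\<close> in a basis
  of \<open>range T\<close> span the range of \<open>S\<close>.\<close>

lemma dim_at_most_adjoint:
  assumes "dim_at_most H r (range T)"
  shows "dim_at_most G r (range S)"
proof -
  interpret flip: adjoint_ops H G S T by (rule flip)
  obtain F where F: "finite F" "card F \<le> r"
    "\<And>y. S y = (\<Sum>f\<in>F. kscale G (kinner H y f) (S f))"
    using finite_rank_expansion[OF assms] by metis
  have "S y \<in> G.span (S ` F)" for y
    unfolding F(3)[of y] by (intro G.span_sum G.span_scale G.span_base imageI)
  moreover have "card (S ` F) \<le> r" using card_image_le[OF F(1), of S] F(2) by linarith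
  ultimately show ?thesis
    using F(1) by (intro G.dim_at_mostI[where A="S ` F"] flip.subspace_range) auto
qed

end

section \<open>The Moore--Penrose inverse\<close>

context adjoint_ops
begin

text \<open>Brings the closure of a range into the form \<open>orth H _\<close> that the projector
  lemmas require.\<close>

lemma closure_range: "closure (range T) = orth H (S -` {0})"
  using H.orth_orth_subspace[OF subspace_range] by (simp add: orth_range)

lemma kernel_eq: "T -` {0} = orth G (range S)"
  by (rule adjoint_ops.orth_range[OF flip, symmetric])

lemma orth_orth_kernel [simp]: "orth G (orth G (T -` {0})) = T -` {0}"
  by (simp add: kernel_eq)

lemma proj_kernel: "T (proj G (orth G (T -` {0})) x) = T x"
  using G.proj_orth(2)[where x=x and S="T -` {0}"] by (simp add: diff)

lemma inj_on_orth_kernel: "inj_on T (orth G (T -` {0}))"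
proof (rule inj_onI)
  fix x y assume *: "x \<in> orth G (T -` {0})" "y \<in> orth G (T -` {0})" "T x = T y"
  then have "x - y \<in> orth G (T -` {0})" by (simp add: G.subspace_diff G.subspace_orth)
  moreover have "x - y \<in> T -` {0}" using *(3) by (simp add: diff)
  ultimately have "x - y = 0" by (rule G.orth_Int)
  then show "x = y" by simp
qed

text \<open>Evaluates the definite description: the range and its complement meet only in 0, so the
  decomposition is unique, and \<open>T\<close> is injective on the complement of its
  kernel.\<close>

lemma mp_inverse_decomp:
  assumes x: "x \<in> orth G (T -` {0})" and k: "k \<in> orth H (range T)"
  shows "mp_inverse G H T (T x + k) = Some x"
proof -
  have inv: "inv_into (orth G (T -` {0})) T (T x) = x"
    by (rule inv_into_f_f[OF inj_on_orth_kernel x])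
  have "h = T x" if h: "h \<in> range T" "k' \<in> orth H (range T)" "T x + k = h + k'" for h k'
  proof -
    have "T x - h \<in> range T" using h(1) subspace_range H.subspace_diff by blast
    moreover have "k' - k \<in> orth H (range T)"
      using h(2) k H.subspace_diff H.subspace_orth by blast
    moreover have "k' - k = T x - h" using h(3) by (simp add: algebra_simps)
    ultimately show ?thesis using H.orth_Int by fastforce
  qed
  then have "(THE z. \<exists>h\<in>range T. \<exists>k'\<in>orth H (range T). T x + k = h + k' \<and>
      z = inv_into (orth G (T -` {0})) T h) = x"
  proof (intro the_equality)
    show "\<exists>h\<in>range T. \<exists>k'\<in>orth H (range T). T x + k = h + k' \<and>
        x = inv_into (orth G (T -` {0})) T h"
      using k inv by (intro bexI[of _ "T x"] bexI[of _ k]) auto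
  qed (use inv in metis)
  moreover have "\<exists>h\<in>range T. \<exists>k'\<in>orth H (range T). T x + k = h + k'"
    using k by blast
  ultimately show ?thesis by (simp add: mp_inverse_def)
qed

text \<open>Characterization by the normal equation: a least-squares solution without kernel
  component. It stands in for the definition in almost all later arguments.\<close>

lemma mp_inverse_eq_Some_iff:
  "mp_inverse G H T y = Some x \<longleftrightarrow> x \<in> orth G (T -` {0}) \<and> S (y - T x) = 0"
proof
  assume *: "x \<in> orth G (T -` {0}) \<and> S (y - T x) = 0"
  then have "y - T x \<in> orth H (range T)" by (simp add: orth_range)
  then show "mp_inverse G H T y = Some x" using mp_inverse_decomp[of x "y - T x"] * by simp
next
  assume mp: "mp_inverse G H T y = Some x"
  then obtain z k where zk: "k \<in> orth H (range T)" "y = T z + k"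
    unfolding mp_inverse_def by (auto split: if_splits)
  \<comment> \<open>The preimage \<open>z\<close> may have a kernel component; projecting removes it
    without changing \<open>T z\<close>.\<close>
  define p where "p = proj G (orth G (T -` {0})) z"
  have p: "p \<in> orth G (T -` {0})" "y = T p + k"
    using G.proj_orth(1) zk(2) by (simp_all add: p_def proj_kernel)
  then have "x = p" using mp mp_inverse_decomp[OF p(1) zk(1)] by simp
  then show "x \<in> orth G (T -` {0}) \<and> S (y - T x) = 0"
    using p zk(1) by (simp add: orth_range)
qed

lemma mp_inverse_range:
  "mp_inverse G H T (T x) = Some (proj G (orth G (T -` {0})) x)"
  using mp_inverse_decomp[OF G.proj_orth(1), of 0 x]
  by (simp add: proj_kernel H.subspace_0 H.subspace_orth)

lemma range_subset_dom_mp_inverse: "range T \<subseteq> dom (mp_inverse G H T)"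
  using mp_inverse_range by auto

text \<open>Split \<open>y\<close> into a part in the closure of the range and an orthogonal part;
  approximate the first from the range and keep the second fixed. Density is what makes continuous
  extensions unique.\<close>

lemma closure_dom_mp_inverse: "closure (dom (mp_inverse G H T)) = UNIV"
proof -
  have "y \<in> closure (dom (mp_inverse G H T))" for y
  proof -
    obtain w where w: "w \<in> closure (range T)" "y - w \<in> orth H (range T)"
      using H.subspace_decomp[OF subspace_range] .
    have "(\<lambda>v. v + (y - w)) ` closure (range T) \<subseteq> closure ((\<lambda>v. v + (y - w)) ` range T)"
      by (rule image_closure_subset) (auto intro!: continuous_intros closure_subset[THEN subsetD])
    moreover have "(\<lambda>v. v + (y - w)) ` range T \<subseteq> dom (mp_inverse G H T)"
      using w(2) by (auto simp: mp_inverse_def dom_def)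
    ultimately have "w + (y - w) \<in> closure (dom (mp_inverse G H T))"
      using w(1) closure_mono by blast
    then show ?thesis by simp
  qed
  then show ?thesis by blast
qed

end

section \<open>Linear partial operators and their rank\<close>

context hilbert_pair
begin

text \<open>Linearity in terms of the graph, which absorbs the domain conditions and composes well
  with \<open>map_comp_Some_iff\<close>.\<close>

lemma linear_operator_iff:
  "linear_operator G H T \<longleftrightarrow> T 0 = Some 0 \<and>
     (\<forall>x y a b. T x = Some a \<longrightarrow> T y = Some b \<longrightarrow> T (x + y) = Some (a + b)) \<and>
     (\<forall>c x a. T x = Some a \<longrightarrow> T (kscale G c x) = Some (kscale H c a))"
  (is "_ \<longleftrightarrow> ?R")
proof
  assume L: "linear_operator G H T"
  then have sub: "G.subspace (dom T)" by (simp add: linear_operator_def)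
  have add: "T (x + y) = Some (a + b)" if "T x = Some a" "T y = Some b" for x y a b
  proof -
    have "x + y \<in> dom T" using that G.subspace_add[OF sub] by blast
    moreover have "the (T (x + y)) = a + b" using L that unfolding linear_operator_def by force
    ultimately show ?thesis by auto
  qed
  have scale: "T (kscale G c x) = Some (kscale H c a)" if "T x = Some a" for c x a
  proof -
    have "kscale G c x \<in> dom T" using that G.subspace_scale[OF sub] by blast
    moreover have "the (T (kscale G c x)) = kscale H c a"
      using L that unfolding linear_operator_def by force
    ultimately show ?thesis by auto
  qed
  obtain a where "T 0 = Some a" using G.subspace_0[OF sub] by blast
  then have "T 0 = Some 0" using scale[of 0 a 0] by simp
  then show ?R using add scale by blast
next
  assume R: ?R
  then have "G.subspace (dom T)" by (intro G.subspaceI) blast+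
  then show "linear_operator G H T"
    using R unfolding linear_operator_def by (auto simp: dom_def)
qed

text \<open>The images of a basis of \<open>V\<close> span a space containing \<open>W\<close>.
  Asking only that \<open>W\<close> be covered by images of \<open>V\<close> suits ranges of
  composites.\<close>

lemma linear_operator_dim_at_most:
  assumes T: "linear_operator G H T" and V: "dim_at_most G r V" "V \<subseteq> dom T"
    and W: "H.subspace W" "\<And>w. w \<in> W \<Longrightarrow> \<exists>v\<in>V. T v = Some w"
  shows "dim_at_most H r W"
proof -
  obtain F where F: "finite F" "card F \<le> r" "G.span F = V"
    using V(1) unfolding dim_at_most_def by blast
  let ?A = "(\<lambda>f. the (T f)) ` F"
  have "\<exists>w\<in>H.span ?A. T v = Some w" if "v \<in> G.span F" for v
    using that
  proof (induction rule: G.span_induct)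
    case base
    show ?case
    proof (rule G.subspaceI)
      show "0 \<in> {v. \<exists>w\<in>H.span ?A. T v = Some w}"
        using T H.span_zero by (auto simp: linear_operator_iff)
      show "x + y \<in> {v. \<exists>w\<in>H.span ?A. T v = Some w}"
        if "x \<in> {v. \<exists>w\<in>H.span ?A. T v = Some w}" "y \<in> {v. \<exists>w\<in>H.span ?A. T v = Some w}" for x y
        using that T H.span_add unfolding linear_operator_iff by blast
      show "kscale G c x \<in> {v. \<exists>w\<in>H.span ?A. T v = Some w}"
        if "x \<in> {v. \<exists>w\<in>H.span ?A. T v = Some w}" for c x
        using that T H.span_scale unfolding linear_operator_iff by blast
    qed
  next
    case (step f)
    then have "f \<in> dom T" using F(3) V(2) G.span_base by blast
    then obtain w where w: "T f = Some w" by blast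
    then have "w \<in> ?A" by (intro image_eqI[where x=f]) (simp_all add: step)
    then show ?case using w by (intro CollectI bexI[of _ w] H.span_base)
  qed
  then have "W \<subseteq> H.span ?A" using W(2) F(3) by fastforce
  moreover have "card ?A \<le> r" using card_image_le[OF F(1)] F(2) le_trans by blast
  ultimately show ?thesis using F(1) by (intro H.dim_at_mostI[OF W(1)]) auto
qed

lemma linear_operator_range:
  "linear_operator G H T \<Longrightarrow> H.subspace (ran T)"
  unfolding linear_operator_iff ran_def by (rule H.subspaceI) blast+

lemma linear_operator_total: "T \<in> bounded_ops G H \<Longrightarrow> linear_operator G H (Some \<circ> T)"
  unfolding linear_operator_iff bounded_ops_iff
  by (simp, metis G.scale_zero_left H.scale_zero_left)

end

lemma linear_operator_comp:
  assumes "hilbert_pair G H" "hilbert_pair H K"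
    and "linear_operator G H T" "linear_operator H K T'"
  shows "linear_operator G K (T' \<circ>\<^sub>m T)"
proof -
  interpret A: hilbert_pair G H by fact
  interpret B: hilbert_pair H K by fact
  interpret hilbert_pair G K ..
  have T: "T 0 = Some 0" "\<And>x y a b. T x = Some a \<Longrightarrow> T y = Some b \<Longrightarrow> T (x + y) = Some (a + b)"
    "\<And>c x a. T x = Some a \<Longrightarrow> T (kscale G c x) = Some (kscale H c a)"
    using assms(3) by (auto simp: A.linear_operator_iff)
  have T': "T' 0 = Some 0" "\<And>x y a b. T' x = Some a \<Longrightarrow> T' y = Some b \<Longrightarrow> T' (x + y) = Some (a + b)"
    "\<And>c x a. T' x = Some a \<Longrightarrow> T' (kscale H c x) = Some (kscale K c a)"
    using assms(4) by (auto simp: B.linear_operator_iff)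
  show ?thesis
    unfolding linear_operator_iff by (auto simp: map_comp_Some_iff T T')
qed

context adjoint_ops
begin

text \<open>Both conditions of \<open>mp_inverse_eq_Some_iff\<close> are linear in the pair of
  argument and value.\<close>

lemma linear_operator_mp_inverse: "linear_operator H G (mp_inverse G H T)"
proof -
  interpret flip: adjoint_ops H G S T by (rule flip)
  have e: "x + y - T (a + b) = (x - T a) + (y - T b)"
    "kscale H c x - T (kscale G c a) = kscale H c (x - T a)" for x y a b c
    by (simp_all add: add scale H.scale_right_diff_distrib)
  show ?thesis
    unfolding flip.linear_operator_iff mp_inverse_eq_Some_iff e
    by (auto simp: flip.add flip.scale G.subspace_0 G.subspace_add G.subspace_scale G.subspace_orth)
qed

lemma dim_at_most_image:
  assumes "dim_at_most G r V" "H.subspace W" "W \<subseteq> T ` V"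
  shows "dim_at_most H r W"
  by (rule linear_operator_dim_at_most[OF linear_operator_total[OF bounded] assms(1) _ assms(2)])
     (use assms(3) in auto)

end

section \<open>Best approximation of finite rank\<close>

text \<open>All adjoints are parameters, so the adjoint problem is an instance of the same locale
  with permuted parameters.\<close>

locale approx_problem =
  G1: hilbert_space G1 + G2: hilbert_space G2 + G3: hilbert_space G3 + G4: hilbert_space G4 +
  N: adjoint_ops G1 G4 N Ns + D: adjoint_ops G3 G4 D Ds + E: adjoint_ops G1 G2 E Es
  for G1 :: "('k::real_or_complex, 'g1::{real_inner,complete_space}) hilbert"
    and G2 :: "('k, 'g2::{real_inner,complete_space}) hilbert"
    and G3 :: "('k, 'g3::{real_inner,complete_space}) hilbert"
    and G4 :: "('k, 'g4::{real_inner,complete_space}) hilbert"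
    and N Ns D Ds E Es +
  fixes r :: nat
  assumes N_hs: "N \<in> hs_ops G1 G4"
begin

text \<open>By \<open>D.closure_range\<close> this is the projector onto the closure of
  \<open>range D\<close>; the kernel form makes \<open>P\<close> and \<open>Q\<close> trade places
  under transposition.\<close>

definition P where "P = proj G4 (orth G4 (Ds -` {0}))"
definition Q where "Q = proj G1 (orth G1 (E -` {0}))"

abbreviation "K \<equiv> \<lambda>x. P (N (Q x))"

lemma adjoint_P: "adjoint_ops G4 G4 P P"
  unfolding P_def by (rule G4.adjoint_ops_proj)

lemma adjoint_Q: "adjoint_ops G1 G1 Q Q"
  unfolding Q_def by (rule G1.adjoint_ops_proj)

sublocale P: adjoint_ops G4 G4 P P by (rule adjoint_P)
sublocale Q: adjoint_ops G1 G1 Q Q by (rule adjoint_Q)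

lemma P_D: "P (D x) = D x"
  unfolding P_def by (rule G4.proj_id) (metis D.closure_range closure_subset rangeI subsetD)

lemma P_P: "P (P x) = P x"
  unfolding P_def by (rule G4.proj_id) (rule G4.proj_orth)

lemma Q_Q: "Q (Q x) = Q x"
  unfolding Q_def by (rule G1.proj_id) (rule G1.proj_orth)

lemma E_Q: "E (Q x) = E x"
  unfolding Q_def by (rule E.proj_kernel)

lemma Y_set_iff:
  "Y \<in> Y_set r G1 G2 G3 G4 N D E \<longleftrightarrow>
     Y \<in> finite_rank_ops r G1 G4 \<and> range Y \<subseteq> dom (mp_inverse G3 G4 D) \<and>
     (\<forall>Z\<in>finite_rank_ops r G1 G4.
        hs_norm G1 (\<lambda>x. K x - Y x) \<le> hs_norm G1 (\<lambda>x. K x - Z x))"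
  by (simp add: Y_set_def D.closure_range P_def Q_def)

lemma adjoint_K: "adjoint_ops G1 G4 K (\<lambda>y. Q (Ns (P y)))"
  using adjoint_ops_comp[OF adjoint_Q adjoint_ops_comp[OF N.adjoint_ops_axioms adjoint_P]] .

lemma K_hs: "K \<in> hs_ops G1 G4"
proof -
  interpret PN: adjoint_ops G1 G4 "\<lambda>x. P (N x)" "\<lambda>y. Ns (P y)"
    by (rule adjoint_ops_comp[OF N.adjoint_ops_axioms adjoint_P])
  show ?thesis
    by (rule PN.hs_comp_right[OF N.hs_comp_left[OF N_hs adjoint_P] adjoint_Q])
qed

text \<open>\<open>Z\<close> is invariant under \<open>P\<close> and \<open>Q\<close>, so it cancels
  from the two outer parts of \<open>N - Z\<close>; these depend on \<open>N\<close> alone.\<close>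

lemma hs_norm_residual:
  assumes Z: "Z \<in> hs_ops G1 G4" "\<And>x. P (Z x) = Z x" "\<And>x. Z (Q x) = Z x"
  shows "(hs_norm G1 (\<lambda>x. N x - Z x))\<^sup>2 = (hs_norm G1 (\<lambda>x. K x - Z x))\<^sup>2
    + (hs_norm G1 (\<lambda>x. N x - P (N x)))\<^sup>2 + (hs_norm G1 (\<lambda>x. P (N x) - K x))\<^sup>2"
proof -
  have "Z \<in> bounded_ops G1 G4" using Z(1) by (simp add: hs_ops_def)
  then have adjZ: "adjoint_ops G1 G4 Z (adj G1 G4 Z)" by (rule N.adjoint_ops_adj)
  interpret R: adjoint_ops G1 G4 "\<lambda>x. N x - Z x" "\<lambda>y. Ns y - adj G1 G4 Z y"
    by (rule adjoint_ops_diff[OF N.adjoint_ops_axioms adjZ])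
  have hs: "(\<lambda>x. N x - Z x) \<in> hs_ops G1 G4" by (rule N.hs_diff[OF N_hs Z(1) adjZ])
  show ?thesis
    using R.hs_norm_split[OF hs, of "Ds -` {0}" "E -` {0}"]
    unfolding P_def[symmetric] Q_def[symmetric] by (simp add: P.diff Z)
qed

text \<open>P Y Q competes with \<open>Y\<close>, so optimality forces the two outer parts of K - Y
  to have norm 0. Those of \<open>K\<close> vanish, hence so do those of \<open>Y\<close>.\<close>

lemma Y_set_fixed:
  assumes Y: "Y \<in> Y_set r G1 G2 G3 G4 N D E"
  shows "P (Y x) = Y x" and "Y (Q x) = Y x"
proof -
  have rank: "dim_at_most G4 r (range Y)" and bnd: "Y \<in> bounded_ops G1 G4"
    and opt: "\<And>Z. Z \<in> finite_rank_ops r G1 G4 \<Longrightarrow>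
        hs_norm G1 (\<lambda>x. K x - Y x) \<le> hs_norm G1 (\<lambda>x. K x - Z x)"
    using Y by (auto simp: Y_set_iff finite_rank_ops_def)
  interpret Y: adjoint_ops G1 G4 Y "adj G1 G4 Y" by (rule N.adjoint_ops_adj[OF bnd])
  let ?Y' = "\<lambda>x. P (Y (Q x))"
  interpret Y': adjoint_ops G1 G4 ?Y' "\<lambda>y. Q (adj G1 G4 Y (P y))"
    by (rule adjoint_ops_comp[OF adjoint_Q adjoint_ops_comp[OF Y.adjoint_ops_axioms adjoint_P]])
  \<comment> \<open>The range of P Y Q is contained in the image under \<open>P\<close> of the range
    of \<open>Y\<close>.\<close>
  have "dim_at_most G4 r (range ?Y')"
    by (rule P.dim_at_most_image[OF rank Y'.subspace_range]) auto
  then have Y'fr: "?Y' \<in> finite_rank_ops r G1 G4" using Y'.bounded by (simp add: finite_rank_ops_def)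
  interpret K: adjoint_ops G1 G4 K "\<lambda>y. Q (Ns (P y))" by (rule adjoint_K)
  let ?T = "\<lambda>x. K x - Y x"
  interpret T: adjoint_ops G1 G4 ?T "\<lambda>y. Q (Ns (P y)) - adj G1 G4 Y y"
    by (rule adjoint_ops_diff[OF adjoint_K Y.adjoint_ops_axioms])
  have T_hs: "?T \<in> hs_ops G1 G4"
    by (rule K.hs_diff[OF K_hs Y.finite_rank_hs[OF rank] Y.adjoint_ops_axioms])
  interpret PT: adjoint_ops G1 G4 "\<lambda>x. P (?T x)" "\<lambda>y. Q (Ns (P (P y))) - adj G1 G4 Y (P y)"
    by (rule adjoint_ops_comp[OF T.adjoint_ops_axioms adjoint_P])
  have PT_hs: "(\<lambda>x. P (?T x)) \<in> hs_ops G1 G4" by (rule T.hs_comp_left[OF T_hs adjoint_P])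
  interpret PTQ: adjoint_ops G1 G4 "\<lambda>x. P (?T (Q x))" "\<lambda>y. Q (Q (Ns (P (P y))) - adj G1 G4 Y (P y))"
    by (rule adjoint_ops_comp[OF adjoint_Q PT.adjoint_ops_axioms])
  have PTQ_hs: "(\<lambda>x. P (?T (Q x))) \<in> hs_ops G1 G4" by (rule PT.hs_comp_right[OF PT_hs adjoint_Q])
  let ?A = "\<lambda>x. ?T x - P (?T x)" and ?B = "\<lambda>x. P (?T x) - P (?T (Q x))"
  interpret A: adjoint_ops G1 G4 ?A
      "\<lambda>y. (Q (Ns (P y)) - adj G1 G4 Y y) - (Q (Ns (P (P y))) - adj G1 G4 Y (P y))"
    by (rule adjoint_ops_diff[OF T.adjoint_ops_axioms PT.adjoint_ops_axioms])
  interpret B: adjoint_ops G1 G4 ?B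
      "\<lambda>y. (Q (Ns (P (P y))) - adj G1 G4 Y (P y)) - Q (Q (Ns (P (P y))) - adj G1 G4 Y (P y))"
    by (rule adjoint_ops_diff[OF PT.adjoint_ops_axioms PTQ.adjoint_ops_axioms])
  have A_hs: "?A \<in> hs_ops G1 G4" by (rule T.hs_diff[OF T_hs PT_hs PT.adjoint_ops_axioms])
  have B_hs: "?B \<in> hs_ops G1 G4" by (rule PT.hs_diff[OF PT_hs PTQ_hs PTQ.adjoint_ops_axioms])
  have "(\<lambda>x. P (?T (Q x))) = (\<lambda>x. K x - ?Y' x)" by (simp add: P.diff P_P Q_Q)
  then have "(hs_norm G1 ?T)\<^sup>2 = (hs_norm G1 (\<lambda>x. K x - ?Y' x))\<^sup>2
      + (hs_norm G1 ?A)\<^sup>2 + (hs_norm G1 ?B)\<^sup>2"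
    using T.hs_norm_split[OF T_hs, of "Ds -` {0}" "E -` {0}"]
    unfolding P_def[symmetric] Q_def[symmetric] by simp
  moreover have "(hs_norm G1 ?T)\<^sup>2 \<le> (hs_norm G1 (\<lambda>x. K x - ?Y' x))\<^sup>2"
    using opt[OF Y'fr] T.hs_norm_nonneg by (rule power_mono)
  ultimately have "(hs_norm G1 ?A)\<^sup>2 + (hs_norm G1 ?B)\<^sup>2 \<le> 0" by linarith
  then have "hs_norm G1 ?A = 0" "hs_norm G1 ?B = 0"
    by (simp_all add: sum_power2_le_zero_iff)
  then have A0: "?A x = 0" and B0: "?B x = 0" for x
    using A.hs_norm_eq_0[OF A_hs] B.hs_norm_eq_0[OF B_hs] by blast+
  have PY: "P (Y x) = Y x" for x using A0[of x] by (simp add: P.diff P_P)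
  then show "P (Y x) = Y x" .
  show "Y (Q x) = Y x" using B0[of x] by (simp add: P.diff P_P Q_Q PY)
qed

text \<open>In general the inverse only gives a least-squares solution, with residual in the kernel
  of \<open>Ds\<close>. Here \<open>P\<close> fixes the residual, which is then also orthogonal to
  that kernel and so vanishes.\<close>

lemma mp_inverse_D_solves:
  assumes "range Y \<subseteq> dom (mp_inverse G3 G4 D)" "\<And>x. P (Y x) = Y x"
  obtains w where "w \<in> orth G3 (D -` {0})" "D w = Y x" "mp_inverse G3 G4 D (Y x) = Some w"
proof -
  obtain w where w: "mp_inverse G3 G4 D (Y x) = Some w" using assms(1) by blast
  then have w': "w \<in> orth G3 (D -` {0})" "Ds (Y x - D w) = 0"
    by (auto simp: D.mp_inverse_eq_Some_iff)
  have "Y x - D w = P (Y x - D w)" by (simp add: P.diff P_D assms(2))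
  then have "Y x - D w \<in> orth G4 (Ds -` {0})" unfolding P_def using G4.proj_orth(1) by metis
  then have "Y x - D w = 0" by (rule G4.orth_Int) (simp add: w')
  then show ?thesis using that w w' by simp
qed

section \<open>The candidate solution and its optimality\<close>

definition solution :: "('g1 \<Rightarrow> 'g4) \<Rightarrow> 'g2 \<rightharpoonup> 'g3" where
  "solution Y = mp_inverse G3 G4 D \<circ>\<^sub>m (Some \<circ> Y) \<circ>\<^sub>m mp_inverse G1 G2 E"

lemma solution_eq_Some_iff:
  "solution Y v = Some w \<longleftrightarrow>
     (\<exists>u. mp_inverse G1 G2 E v = Some u \<and> mp_inverse G3 G4 D (Y u) = Some w)"
  by (auto simp: solution_def map_comp_Some_iff)

lemma linear_operator_solution:
  assumes "Y \<in> bounded_ops G1 G4"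
  shows "linear_operator G2 G3 (solution Y)"
proof -
  have p: "hilbert_pair G2 G1" "hilbert_pair G1 G4" "hilbert_pair G4 G3" "hilbert_pair G1 G3" ..
  show ?thesis
    unfolding solution_def
    by (intro linear_operator_comp[OF p(1,4)] linear_operator_comp[OF p(2,3)]
        E.linear_operator_mp_inverse D.linear_operator_mp_inverse
        N.linear_operator_total assms)
qed

lemma dom_solution:
  assumes "range Y \<subseteq> dom (mp_inverse G3 G4 D)"
  shows "dom (solution Y) = dom (mp_inverse G1 G2 E)"
  using assms by (auto simp: dom_def solution_eq_Some_iff) blast

text \<open>\<open>E\<close> followed by its Moore-Penrose inverse is \<open>Q\<close>, which
  \<open>Y\<close> absorbs; the inverse of \<open>D\<close> is exact on values of
  \<open>Y\<close>.\<close>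

lemma solution_E:
  assumes "range Y \<subseteq> dom (mp_inverse G3 G4 D)" "\<And>x. P (Y x) = Y x" "\<And>x. Y (Q x) = Y x"
  obtains w where "solution Y (E x) = Some w" "D w = Y x"
proof -
  obtain w where w: "D w = Y (Q x)" "mp_inverse G3 G4 D (Y (Q x)) = Some w"
    using mp_inverse_D_solves[OF assms(1,2), of "Q x"] by metis
  then have "solution Y (E x) = Some w"
    using E.mp_inverse_range[of x] by (auto simp: solution_eq_Some_iff Q_def)
  then show ?thesis using that w assms(3) by simp
qed

lemma sandwich_solution:
  assumes "range Y \<subseteq> dom (mp_inverse G3 G4 D)" "\<And>x. P (Y x) = Y x" "\<And>x. Y (Q x) = Y x"
  shows "sandwich D (solution Y) E = Y"
proof
  fix x
  obtain w where "solution Y (E x) = Some w" "D w = Y x" using solution_E[OF assms] .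
  then show "sandwich D (solution Y) E x = Y x" by (simp add: sandwich_def)
qed

text \<open>For every admissible \<open>X\<close>, the operator D X E has rank at most
  \<open>r\<close> and is invariant under \<open>P\<close> and \<open>Q\<close>. It thus competes
  with \<open>Y\<close> in approximating \<open>K\<close>, and \<open>hs_norm_residual\<close>
  carries the comparison over to \<open>N\<close>.\<close>

lemma is_solution_solution:
  assumes Y: "Y \<in> Y_set r G1 G2 G3 G4 N D E"
  shows "is_solution r G1 G2 G3 G4 N D E (solution Y)"
proof -
  have rank: "dim_at_most G4 r (range Y)" and bnd: "Y \<in> bounded_ops G1 G4"
    and ran: "range Y \<subseteq> dom (mp_inverse G3 G4 D)"
    and opt: "\<And>Z. Z \<in> finite_rank_ops r G1 G4 \<Longrightarrow>
        hs_norm G1 (\<lambda>x. K x - Y x) \<le> hs_norm G1 (\<lambda>x. K x - Z x)"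
    using Y by (auto simp: Y_set_iff finite_rank_ops_def)
  note fixed = Y_set_fixed[OF Y]
  interpret Y: adjoint_ops G1 G4 Y "adj G1 G4 Y" by (rule N.adjoint_ops_adj[OF bnd])
  have Y_hs: "Y \<in> hs_ops G1 G4" by (rule Y.finite_rank_hs[OF rank])
  have sand: "sandwich D (solution Y) E = Y" by (rule sandwich_solution[OF ran fixed])
  have lin: "linear_operator G2 G3 (solution Y)" by (rule linear_operator_solution[OF bnd])
  have p: "hilbert_pair G2 G3" "hilbert_pair G4 G3" ..
  have "dim_at_most G3 r (ran (solution Y))"
  proof (rule hilbert_pair.linear_operator_dim_at_most[OF p(2) D.linear_operator_mp_inverse rank ran])
    show "G3.subspace (ran (solution Y))"
      by (rule hilbert_pair.linear_operator_range[OF p(1) lin])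
    show "\<exists>v\<in>range Y. mp_inverse G3 G4 D v = Some w" if "w \<in> ran (solution Y)" for w
      using that by (auto simp: ran_def solution_eq_Some_iff)
  qed
  then have member: "solution Y \<in> X_set r G1 G2 G3 G4 D E"
    using lin Y_hs by (simp add: X_set_def sand dom_solution[OF ran])
  have "hs_norm G1 (\<lambda>x. N x - Y x) \<le> hs_norm G1 (\<lambda>x. N x - sandwich D X E x)"
    if X: "X \<in> X_set r G1 G2 G3 G4 D E" for X
  proof -
    let ?Z = "sandwich D X E"
    have dom: "dom (mp_inverse G1 G2 E) \<subseteq> dom X" and Xrank: "dim_at_most G3 r (ran X)"
      and Z_hs: "?Z \<in> hs_ops G1 G4" using X by (auto simp: X_set_def)
    then have Z_bnd: "?Z \<in> bounded_ops G1 G4" by (simp add: hs_ops_def)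
    interpret Z: adjoint_ops G1 G4 ?Z "adj G1 G4 ?Z" by (rule N.adjoint_ops_adj[OF Z_bnd])
    have "?Z x \<in> D ` ran X" for x
    proof -
      have "E x \<in> dom X" using dom E.range_subset_dom_mp_inverse by blast
      then show ?thesis by (auto simp: sandwich_def intro: ranI)
    qed
    then have "dim_at_most G4 r (range ?Z)"
      by (intro D.dim_at_most_image[OF Xrank Z.subspace_range]) blast
    then have "?Z \<in> finite_rank_ops r G1 G4" using Z_bnd by (simp add: finite_rank_ops_def)
    then have "hs_norm G1 (\<lambda>x. K x - Y x) \<le> hs_norm G1 (\<lambda>x. K x - ?Z x)" by (rule opt)
    moreover have "0 \<le> hs_norm G1 (\<lambda>x. K x - Y x)" by (simp add: hs_norm_def infsum_nonneg)
    ultimately have "(hs_norm G1 (\<lambda>x. K x - Y x))\<^sup>2 \<le> (hs_norm G1 (\<lambda>x. K x - ?Z x))\<^sup>2"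
      by (rule power_mono)
    moreover have "P (?Z x) = ?Z x" "?Z (Q x) = ?Z x" for x by (simp_all add: sandwich_def P_D E_Q)
    ultimately have "(hs_norm G1 (\<lambda>x. N x - Y x))\<^sup>2 \<le> (hs_norm G1 (\<lambda>x. N x - ?Z x))\<^sup>2"
      by (simp add: hs_norm_residual[OF Y_hs fixed] hs_norm_residual[OF Z_hs])
    then show ?thesis by (rule power2_le_imp_le) (simp add: hs_norm_def infsum_nonneg)
  qed
  then show ?thesis using member by (simp add: is_solution_def sand)
qed

text \<open>By the normal equation the inverse of \<open>E\<close> sees its argument only through
  \<open>Es\<close>, which annihilates the part orthogonal to \<open>range E\<close>. On the other
  side, values of the inverse of \<open>D\<close> are already orthogonal to the kernel of
  \<open>D\<close>.\<close>

lemma solution_proj: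
  assumes x: "x \<in> dom (solution Y)"
  shows "((Some \<circ> proj G3 (orth G3 (D -` {0}))) \<circ>\<^sub>m solution Y \<circ>\<^sub>m
      (Some \<circ> proj G2 (closure (range E)))) x = solution Y x"
proof -
  define R where "R = proj G2 (closure (range E))"
  have "x - R x \<in> orth G2 (orth G2 (Es -` {0}))"
    unfolding R_def E.closure_range by (rule G2.proj_orth)
  then have "Es (x - R x) = 0"
    using adjoint_ops.orth_orth_kernel[OF E.flip] by auto
  then have "Es x = Es (R x)" by (simp add: adjoint_ops.diff[OF E.flip])
  then have "mp_inverse G1 G2 E (R x) = Some u \<longleftrightarrow> mp_inverse G1 G2 E x = Some u" for u
    by (simp add: E.mp_inverse_eq_Some_iff adjoint_ops.diff[OF E.flip])
  then have eq: "solution Y (R x) = solution Y x"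
    unfolding solution_def by (metis map_comp_def option.exhaust)
  obtain w where w: "solution Y x = Some w" using x by blast
  then have "w \<in> orth G3 (D -` {0})"
    by (auto simp: solution_eq_Some_iff D.mp_inverse_eq_Some_iff)
  then have "proj G3 (orth G3 (D -` {0})) w = w" by (rule G3.proj_id)
  then show ?thesis using w eq by (simp add: R_def[symmetric] map_comp_def)
qed

text \<open>With \<open>v\<close> the value of the inverse of \<open>E\<close> at \<open>u\<close>,
  the residual u - E v is in the kernel of \<open>Es\<close>, to which \<open>g f\<close> is
  orthogonal; so <v, a f> = <E v, g f> = <u, g f>. This removes the possibly unbounded inverse and
  leaves a formula that is bounded in \<open>u\<close>.\<close>

lemma solution_finite_sum:
  assumes F: "finite F" "\<And>x. Y x = (\<Sum>f\<in>F. kscale G4 (kinner G1 x (a f)) (b f))"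
    and g: "\<And>f. f \<in> F \<Longrightarrow> g f \<in> orth G2 (Es -` {0})" "\<And>f. f \<in> F \<Longrightarrow> Es (g f) = a f"
    and w: "\<And>f. f \<in> F \<Longrightarrow> w f \<in> orth G3 (D -` {0})" "\<And>f. f \<in> F \<Longrightarrow> D (w f) = b f"
    and u: "u \<in> dom (mp_inverse G1 G2 E)"
  shows "solution Y u = Some (\<Sum>f\<in>F. kscale G3 (kinner G2 u (g f)) (w f))"
proof -
  obtain v where v: "mp_inverse G1 G2 E u = Some v" using u by blast
  then have "u - E v \<in> Es -` {0}" by (simp add: E.mp_inverse_eq_Some_iff)
  then have "kinner G2 (u - E v) (g f) = 0" if "f \<in> F" for f
    using g(1)[OF that] G2.kinner_eq_0_commute by (auto simp: orth_def)
  then have eq: "kinner G1 v (a f) = kinner G2 u (g f)" if "f \<in> F" for f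
    using that by (simp add: g(2)[symmetric] E.adjoint[symmetric] G2.kinner_diff_left)
  let ?x = "\<Sum>f\<in>F. kscale G3 (kinner G2 u (g f)) (w f)"
  have "D ?x = Y v" by (simp add: F(2) D.sum D.scale w(2) eq)
  moreover have "?x \<in> orth G3 (D -` {0})"
    by (intro G3.subspace_sum G3.subspace_scale G3.subspace_orth w(1))
  ultimately have "mp_inverse G3 G4 D (Y v) = Some ?x"
    by (simp add: D.mp_inverse_eq_Some_iff adjoint_ops.zero[OF D.flip])
  then show ?thesis using v by (auto simp: solution_eq_Some_iff)
qed

text \<open>A range inclusion in the spirit of Douglas: boundedness of an \<open>X\<close> with Es X
  Ds = Ys makes \<open>u \<mapsto> <X u, E x>\<close> a bounded functional on \<open>dom X\<close>,
  and its representative solves D w = Y x.\<close>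

lemma range_subset_of_bounded_adjoint:
  assumes X: "linear_operator G3 G2 X" "bounded_operator X"
    and Y: "adjoint_ops G1 G4 Y Ys" and EXD: "\<And>z. \<exists>t. X (Ds z) = Some t \<and> Es t = Ys z"
  shows "range Y \<subseteq> range D"
proof
  interpret Y: adjoint_ops G1 G4 Y Ys by fact
  obtain c where c: "\<And>u. u \<in> dom X \<Longrightarrow> norm (the (X u)) \<le> c * norm u"
    using X(2) by (auto simp: bounded_operator_def)
  fix y assume "y \<in> range Y"
  then obtain x where x: "y = Y x" by blast
  have "\<exists>w\<in>closure (dom X). \<forall>u\<in>dom X. kinner G2 (the (X u)) (E x) = kinner G3 u w"
  proof (rule G3.riesz)
    show "G3.subspace (dom X)" using X(1) by (simp add: linear_operator_def)
    show "kinner G2 (the (X (u + v))) (E x) = kinner G2 (the (X u)) (E x) + kinner G2 (the (X v)) (E x)"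
      if "u \<in> dom X" "v \<in> dom X" for u v
      using X(1) that by (simp add: linear_operator_def G2.kinner_add_left)
    show "kinner G2 (the (X (kscale G3 a u))) (E x) = a * kinner G2 (the (X u)) (E x)"
      if "u \<in> dom X" for a u
      using X(1) that by (simp add: linear_operator_def G2.kinner_scale_left)
    show "norm (kinner G2 (the (X u)) (E x)) \<le> (c * norm (E x)) * norm u" if "u \<in> dom X" for u
      using G2.norm_kinner_le[of "the (X u)" "E x"] mult_right_mono[OF c[OF that], of "norm (E x)"]
      by (simp add: mult_ac)
  qed
  then obtain w where w: "\<And>u. u \<in> dom X \<Longrightarrow> kinner G2 (the (X u)) (E x) = kinner G3 u w" by blast
  \<comment> \<open>The vectors \<open>Ds z\<close> lie in \<open>dom X\<close>, and testing the
    representative on them determines \<open>D w\<close>.\<close>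
  have "kinner G4 z (Y x) = kinner G4 z (D w)" for z
  proof -
    obtain t where t: "X (Ds z) = Some t" "Es t = Ys z" using EXD by blast
    have "kinner G4 z (Y x) = kinner G1 (Es t) x" by (simp add: Y.adjoint' t(2))
    also have "\<dots> = kinner G2 (the (X (Ds z))) (E x)" by (simp add: E.adjoint' t(1))
    also have "\<dots> = kinner G3 (Ds z) w" by (rule w) (simp add: t(1) domI)
    also have "\<dots> = kinner G4 z (D w)" by (simp add: D.adjoint')
    finally show ?thesis .
  qed
  then have "Y x = D w" by (rule G4.kinner_eqI_right)
  then show "y \<in> range D" by (simp add: x)
qed

end

section \<open>The direct and the adjoint problem\<close>

context adjoint_ops
begin

lemma continuous_on: "continuous_on A T"
proof -
  obtain c where "\<And>x. norm (T x) \<le> c * norm x" using ex_bound by blast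
  then have "bounded_linear T"
    by (intro bounded_linear_intro[where K=c])
       (simp_all add: add mult.commute[of _ c] G.kscale_of_real[symmetric] H.kscale_of_real[symmetric]
         scale)
  then show ?thesis by (rule linear_continuous_on)
qed

end

lemma (in hilbert_pair) adjoint_ops_finite_sum:
  assumes "finite F"
  shows "adjoint_ops G H (\<lambda>x. \<Sum>f\<in>F. kscale H (kinner G x (a f)) (b f))
    (\<lambda>y. \<Sum>f\<in>F. kscale G (kinner H y (b f)) (a f))"
proof
  let ?T = "\<lambda>x. \<Sum>f\<in>F. kscale H (kinner G x (a f)) (b f)"
  have "norm (?T x) \<le> (\<Sum>f\<in>F. norm (a f) * norm (b f)) * norm x" for x
  proof -
    have "norm (kscale H (kinner G x (a f)) (b f)) \<le> norm (a f) * norm (b f) * norm x" for f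
      using mult_right_mono[OF G.norm_kinner_le[of x "a f"], of "norm (b f)"] by (simp add: mult_ac)
    then show ?thesis unfolding sum_distrib_right by (intro sum_norm_le)
  qed
  then show "?T \<in> bounded_ops G H"
    by (auto simp: bounded_ops_iff G.kinner_simps H.scale_left_distrib sum.distrib
        H.scale_sum_right)
  show "kinner H (?T x) y = kinner G x (\<Sum>f\<in>F. kscale G (kinner H y (b f)) (a f))" for x y
    by (simp add: H.kinner_sum_left G.kinner_sum_right H.kinner_scale_left G.kinner_scale_right
        H.kinner_commute[symmetric] mult.commute)
qed

text \<open>Continuous functions that agree on a dense set are equal, which settles uniqueness in
  the definite description.\<close>

lemma extension_eqI:
  assumes "closure (dom X) = UNIV" "continuous_on UNIV T" "\<And>u. u \<in> dom X \<Longrightarrow> X u = Some (T u)"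
  shows "extension X = T"
  unfolding extension_def
proof (rule the_equality)
  show "continuous_on UNIV T \<and> X \<subseteq>\<^sub>m (Some \<circ> T)" using assms by (simp add: map_le_def)
  fix S assume S: "continuous_on UNIV S \<and> X \<subseteq>\<^sub>m (Some \<circ> S)"
  have "dom X \<subseteq> {x. S x = T x}"
  proof
    fix u assume u: "u \<in> dom X"
    then have "X u = Some (S u)" using S by (simp add: map_le_def)
    then show "u \<in> {x. S x = T x}" using assms(3)[OF u] by simp
  qed
  moreover have "closed {x. S x = T x}" using S assms(2) by (intro closed_Collect_eq) auto
  ultimately have "closure (dom X) \<subseteq> {x. S x = T x}" by (rule closure_minimal)
  then show "S = T" using assms(1) by auto
qed

section \<open>Transposition between the adjoint and the direct problem\<close>

context approx_problem
begin

lemma transposed: "approx_problem G4 G3 G2 G1 Ns N Es E Ds D"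
proof -
  interpret Ns: adjoint_ops G4 G1 Ns N by (rule N.flip)
  interpret Ds: adjoint_ops G4 G3 Ds D by (rule D.flip)
  interpret Es: adjoint_ops G2 G1 Es E by (rule E.flip)
  show ?thesis by unfold_locales (rule N.hs_adjoint[OF N_hs])
qed

context
  fixes Y Ys
  assumes adjoint_Y: "adjoint_ops G1 G4 Y Ys"
    and Ys: "Ys \<in> Y_set r G4 G3 G2 G1 Ns Es Ds"
begin

interpretation t: approx_problem G4 G3 G2 G1 Ns N Es E Ds D r
  by (rule transposed)

lemma P_Q_transposed: "t.P = Q" "t.Q = P"
  by (simp_all add: t.P_def t.Q_def P_def Q_def)

text \<open>\<open>Y\<close> is not yet known to belong to its own set of best approximations, so
  its invariance is inherited from \<open>Ys\<close> by adjunction.\<close>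

lemma transposed_Y_set_fixed: "P (Y x) = Y x" "Y (Q x) = Y x"
proof -
  interpret Y: adjoint_ops G1 G4 Y Ys by (rule adjoint_Y)
  note fixed = t.Y_set_fixed[OF Ys, unfolded P_Q_transposed]
  show "P (Y x) = Y x"
    by (rule G4.kinner_eqI_left) (simp add: P.adjoint Y.adjoint fixed)
  show "Y (Q x) = Y x"
    by (rule G4.kinner_eqI_left) (simp add: Q.adjoint Y.adjoint fixed)
qed

text \<open>Taking adjoints preserves the rank bound and the Hilbert-Schmidt distance to
  \<open>K\<close>, so optimality of \<open>Ys\<close> passes to \<open>Y\<close>. Only the range
  condition is not self-dual.\<close>

lemma Y_set_iff_range_subset:
  "Y \<in> Y_set r G1 G2 G3 G4 N D E \<longleftrightarrow> range Y \<subseteq> dom (mp_inverse G3 G4 D)"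
proof
  assume ran: "range Y \<subseteq> dom (mp_inverse G3 G4 D)"
  interpret Y: adjoint_ops G1 G4 Y Ys by (rule adjoint_Y)
  interpret Ys: adjoint_ops G4 G1 Ys Y by (rule Y.flip)
  have rankYs: "dim_at_most G1 r (range Ys)"
    and opt: "\<And>Z. Z \<in> finite_rank_ops r G4 G1 \<Longrightarrow>
        hs_norm G4 (\<lambda>y. Q (Ns (P y)) - Ys y) \<le> hs_norm G4 (\<lambda>y. Q (Ns (P y)) - Z y)"
    using Ys unfolding t.Y_set_iff P_Q_transposed by (auto simp: finite_rank_ops_def)
  have norm_eq: "hs_norm G4 (\<lambda>y. Q (Ns (P y)) - Zs y) = hs_norm G1 (\<lambda>x. K x - Z x)"
    if Z: "adjoint_ops G1 G4 Z Zs" "dim_at_most G4 r (range Z)" for Z Zs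
  proof -
    interpret Z: adjoint_ops G1 G4 Z Zs by (rule Z(1))
    interpret K: adjoint_ops G1 G4 K "\<lambda>y. Q (Ns (P y))" by (rule adjoint_K)
    interpret R: adjoint_ops G1 G4 "\<lambda>x. K x - Z x" "\<lambda>y. Q (Ns (P y)) - Zs y"
      by (rule adjoint_ops_diff[OF adjoint_K Z(1)])
    show ?thesis
      by (rule R.hs_adjoint[OF K.hs_diff[OF K_hs Z.finite_rank_hs[OF Z(2)] Z(1)]])
  qed
  have rankY: "dim_at_most G4 r (range Y)" by (rule Ys.dim_at_most_adjoint[OF rankYs])
  have "hs_norm G1 (\<lambda>x. K x - Y x) \<le> hs_norm G1 (\<lambda>x. K x - Z x)"
    if Z: "Z \<in> finite_rank_ops r G1 G4" for Z
  proof -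
    have Z': "Z \<in> bounded_ops G1 G4" "dim_at_most G4 r (range Z)"
      using Z by (simp_all add: finite_rank_ops_def)
    interpret Z: adjoint_ops G1 G4 Z "adj G1 G4 Z" by (rule N.adjoint_ops_adj[OF Z'(1)])
    have "adj G1 G4 Z \<in> finite_rank_ops r G4 G1"
      using Z.dim_at_most_adjoint[OF Z'(2)] adjoint_ops.bounded[OF Z.flip]
      by (simp add: finite_rank_ops_def)
    then show ?thesis
      using opt norm_eq[OF adjoint_Y rankY] norm_eq[OF Z.adjoint_ops_axioms Z'(2)] by metis
  qed
  then show "Y \<in> Y_set r G1 G2 G3 G4 N D E"
    using ran rankY Y.bounded by (simp add: Y_set_iff finite_rank_ops_def)
qed (simp add: Y_set_iff)

text \<open>\<open>t.solution Ys\<close> serves as the intertwining operator: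
  \<open>t.solution_E\<close> gives Es X Ds = Ys.\<close>

lemma range_subset_if_bounded:
  assumes "bounded_operator (t.solution Ys)"
  shows "range Y \<subseteq> dom (mp_inverse G3 G4 D)"
proof -
  have Ys': "Ys \<in> bounded_ops G4 G1" "range Ys \<subseteq> dom (mp_inverse G2 G1 Es)"
    using Ys by (auto simp: t.Y_set_iff finite_rank_ops_def)
  have "range Y \<subseteq> range D"
  proof (rule range_subset_of_bounded_adjoint[OF t.linear_operator_solution[OF Ys'(1)] assms adjoint_Y])
    show "\<exists>t. t.solution Ys (Ds z) = Some t \<and> Es t = Ys z" for z
      using t.solution_E[OF Ys'(2) t.Y_set_fixed[OF Ys]] by metis
  qed
  then show ?thesis using D.range_subset_dom_mp_inverse by blast
qed

lemma solutions_expansion: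
  assumes ran: "range Y \<subseteq> dom (mp_inverse G3 G4 D)"
  obtains F :: "'g1 set" and w g where "finite F"
    "\<And>y. y \<in> dom (mp_inverse G4 G3 Ds) \<Longrightarrow>
       t.solution Ys y = Some (\<Sum>f\<in>F. kscale G2 (kinner G3 y (w f)) (g f))"
    "\<And>u. u \<in> dom (mp_inverse G1 G2 E) \<Longrightarrow>
       solution Y u = Some (\<Sum>f\<in>F. kscale G3 (kinner G2 u (g f)) (w f))"
proof -
  interpret Ys: adjoint_ops G4 G1 Ys Y by (rule adjoint_ops.flip[OF adjoint_Y])
  have rank: "dim_at_most G1 r (range Ys)" and ranYs: "range Ys \<subseteq> dom (mp_inverse G2 G1 Es)"
    using Ys by (auto simp: t.Y_set_iff finite_rank_ops_def)
  show ?thesis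
  proof (rule Ys.finite_rank_expansion[OF rank])
    fix F assume F: "finite F" "card F \<le> r" "orthonormal G1 F" "G1.span F = range Ys"
      "\<And>z. Ys z = (\<Sum>f\<in>F. kscale G1 (kinner G4 z (Y f)) f)"
      "\<And>x. Y x = (\<Sum>f\<in>F. kscale G4 (kinner G1 x f) (Y f))"
    \<comment> \<open>The vectors \<open>w f\<close> come from the range assumption on
      \<open>Y\<close>; the \<open>g f\<close> below come from that on \<open>Ys\<close>, and only
      for \<open>f\<close> in its range.\<close>
    have "\<exists>v. v \<in> orth G3 (D -` {0}) \<and> D v = Y f" for f
      using mp_inverse_D_solves[OF ran transposed_Y_set_fixed(1)] by metis
    then obtain w where w: "\<And>f. w f \<in> orth G3 (D -` {0})" "\<And>f. D (w f) = Y f" by metis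
    have "\<exists>v. v \<in> orth G2 (Es -` {0}) \<and> Es v = f" if "f \<in> F" for f
    proof -
      have "f \<in> range Ys" using that F(4) G1.span_base by blast
      then show ?thesis using t.mp_inverse_D_solves[OF ranYs t.Y_set_fixed(1)[OF Ys]] by (metis imageE)
    qed
    then obtain g where g: "\<And>f. f \<in> F \<Longrightarrow> g f \<in> orth G2 (Es -` {0})" "\<And>f. f \<in> F \<Longrightarrow> Es (g f) = f"
      by metis
    show ?thesis
    proof (rule that[OF F(1)])
      show "t.solution Ys y = Some (\<Sum>f\<in>F. kscale G2 (kinner G3 y (w f)) (g f))"
        if "y \<in> dom (mp_inverse G4 G3 Ds)" for y
        by (rule t.solution_finite_sum[OF F(1,5)]) (use w g that in auto)
      show "solution Y u = Some (\<Sum>f\<in>F. kscale G3 (kinner G2 u (g f)) (w f))"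
        if "u \<in> dom (mp_inverse G1 G2 E)" for u
        by (rule solution_finite_sum[OF F(1,6)]) (use w g that in auto)
    qed
  qed
qed

lemma solutions_bounded:
  assumes ran: "range Y \<subseteq> dom (mp_inverse G3 G4 D)"
  shows "bounded_operator (t.solution Ys)" "bounded_operator (solution Y)"
    "extension (solution Y) = adj G3 G2 (extension (t.solution Ys))"
proof -
  obtain F :: "'g1 set" and w g where F: "finite F" and
    Xa: "\<And>y. y \<in> dom (mp_inverse G4 G3 Ds) \<Longrightarrow>
       t.solution Ys y = Some (\<Sum>f\<in>F. kscale G2 (kinner G3 y (w f)) (g f))" and
    Xd: "\<And>u. u \<in> dom (mp_inverse G1 G2 E) \<Longrightarrow>
       solution Y u = Some (\<Sum>f\<in>F. kscale G3 (kinner G2 u (g f)) (w f))"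
    by (rule solutions_expansion[OF ran]) blast
  let ?A = "\<lambda>y. \<Sum>f\<in>F. kscale G2 (kinner G3 y (w f)) (g f)"
  let ?B = "\<lambda>u. \<Sum>f\<in>F. kscale G3 (kinner G2 u (g f)) (w f)"
  interpret p: hilbert_pair G3 G2 ..
  \<comment> \<open>Swapping the two vector families in a finite sum of rank-one operators gives the
    adjoint sum, so both sums are bounded and mutually adjoint.\<close>
  interpret A: adjoint_ops G3 G2 ?A ?B by (rule p.adjoint_ops_finite_sum[OF F])
  interpret B: adjoint_ops G2 G3 ?B ?A by (rule A.flip)
  have ranYs: "range Ys \<subseteq> dom (mp_inverse G2 G1 Es)" using Ys by (simp add: t.Y_set_iff)
  note domA = t.dom_solution[OF ranYs] and domB = dom_solution[OF ran]
  show "bounded_operator (t.solution Ys)"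
    using A.ex_bound unfolding bounded_operator_def domA by (simp add: Xa) blast
  show "bounded_operator (solution Y)"
    using B.ex_bound unfolding bounded_operator_def domB by (simp add: Xd) blast
  \<comment> \<open>Each solution agrees with its finite sum on its dense domain, hence extends to
    it.\<close>
  have "extension (t.solution Ys) = ?A"
    by (rule extension_eqI) (simp_all add: domA adjoint_ops.closure_dom_mp_inverse[OF D.flip]
        A.continuous_on Xa)
  moreover have "extension (solution Y) = ?B"
    by (rule extension_eqI) (simp_all add: domB E.closure_dom_mp_inverse B.continuous_on Xd)
  ultimately show "extension (solution Y) = adj G3 G2 (extension (t.solution Ys))"
    by (simp add: A.adj_eq)
qed

end

end

theorem proposition5p7:
  fixes H1 :: "('k::real_or_complex, 'h1::{real_inner,complete_space}) hilbert"
    and H2 :: "('k, 'h2::{real_inner,complete_space}) hilbert"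
    and H3 :: "('k, 'h3::{real_inner,complete_space}) hilbert"
    and H4 :: "('k, 'h4::{real_inner,complete_space}) hilbert"
    and r :: nat
    and M Y :: "'h1 \<Rightarrow> 'h4" and B :: "'h3 \<Rightarrow> 'h4" and C :: "'h1 \<Rightarrow> 'h2"
  defines "Ms \<equiv> adj H1 H4 M" and "Ys \<equiv> adj H1 H4 Y"
    and "Bs \<equiv> adj H3 H4 B" and "Cs \<equiv> adj H1 H2 C"
  defines "Xa \<equiv> mp_inverse H2 H1 Cs \<circ>\<^sub>m (Some \<circ> Ys) \<circ>\<^sub>m mp_inverse H4 H3 Bs"
    and "Xd \<equiv> mp_inverse H3 H4 B \<circ>\<^sub>m (Some \<circ> Y) \<circ>\<^sub>m mp_inverse H1 H2 C"
    and "P \<equiv> proj H2 (closure (range C))"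
    and "Q \<equiv> proj H3 (orth H3 (B -` {0}))"
  assumes "hilbert_space H1" "hilbert_space H2" "hilbert_space H3" "hilbert_space H4"
    and "separable_space (euclidean :: 'h1 topology)" "separable_space (euclidean :: 'h2 topology)"
    and "separable_space (euclidean :: 'h3 topology)" "separable_space (euclidean :: 'h4 topology)"
    and "M \<in> hs_ops H1 H4" "B \<in> bounded_ops H3 H4" "C \<in> bounded_ops H1 H2"
    and "Y \<in> bounded_ops H1 H4"
    and "Ys \<in> Y_set r H4 H3 H2 H1 Ms Cs Bs"
  shows "is_solution r H4 H3 H2 H1 Ms Cs Bs Xa
    \<and> (\<forall>x\<in>dom Xa. ((Some \<circ> P) \<circ>\<^sub>m Xa \<circ>\<^sub>m (Some \<circ> Q)) x = Xa x)
    \<and> (bounded_operator Xa \<longleftrightarrow> Y \<in> Y_set r H1 H2 H3 H4 M B C)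
    \<and> (Y \<in> Y_set r H1 H2 H3 H4 M B C \<longrightarrow>
         is_solution r H1 H2 H3 H4 M B C Xd
         \<and> bounded_operator Xd
         \<and> (\<forall>x\<in>dom Xd. Xd x = ((Some \<circ> Q) \<circ>\<^sub>m Xd \<circ>\<^sub>m (Some \<circ> P)) x)
         \<and> extension Xd = adj H3 H2 (extension Xa))"
proof -
  interpret H1: hilbert_space H1 by fact
  interpret H2: hilbert_space H2 by fact
  interpret H3: hilbert_space H3 by fact
  interpret H4: hilbert_space H4 by fact
  have pairs: "hilbert_pair H1 H4" "hilbert_pair H3 H4" "hilbert_pair H1 H2" ..
  have "M \<in> bounded_ops H1 H4" using \<open>M \<in> hs_ops H1 H4\<close> by (simp add: hs_ops_def)
  then interpret M: adjoint_ops H1 H4 M Ms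
    unfolding Ms_def by (rule hilbert_pair.adjoint_ops_adj[OF pairs(1)])
  interpret B: adjoint_ops H3 H4 B Bs
    unfolding Bs_def by (rule hilbert_pair.adjoint_ops_adj[OF pairs(2)]) fact
  interpret C: adjoint_ops H1 H2 C Cs
    unfolding Cs_def by (rule hilbert_pair.adjoint_ops_adj[OF pairs(3)]) fact
  have adjoint_Y: "adjoint_ops H1 H4 Y Ys"
    unfolding Ys_def by (rule hilbert_pair.adjoint_ops_adj[OF pairs(1)]) fact
  interpret d: approx_problem H1 H2 H3 H4 M Ms B Bs C Cs r
    by unfold_locales fact
  interpret a: approx_problem H4 H3 H2 H1 Ms M Cs C Bs B r
    by (rule d.transposed)
  note Ys = \<open>Ys \<in> Y_set r H4 H3 H2 H1 Ms Cs Bs\<close>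
  note Y = adjoint_Y Ys
  have Xa: "Xa = a.solution Ys" and Xd: "Xd = d.solution Y"
    by (simp_all add: Xa_def Xd_def a.solution_def d.solution_def)
  \<comment> \<open>\<open>P\<close> and \<open>Q\<close> are rewritten as range and kernel
    projectors of the adjoints, the form in which \<open>a.solution_proj\<close> states the
    invariance of \<open>Xa\<close>.\<close>
  have P: "P = proj H2 (orth H2 (Cs -` {0}))" by (simp add: P_def C.closure_range)
  have Q: "Q = proj H3 (closure (range Bs))"
    by (simp add: Q_def adjoint_ops.closure_range[OF B.flip])
  have "bounded_operator Xa \<longleftrightarrow> Y \<in> Y_set r H1 H2 H3 H4 M B C"
    using d.range_subset_if_bounded[OF Y] d.solutions_bounded(1)[OF Y] d.Y_set_iff_range_subset[OF Y]
    unfolding Xa by blast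
  moreover have "is_solution r H4 H3 H2 H1 Ms Cs Bs Xa"
    unfolding Xa by (rule a.is_solution_solution[OF Ys])
  moreover have "((Some \<circ> P) \<circ>\<^sub>m Xa \<circ>\<^sub>m (Some \<circ> Q)) x = Xa x" if "x \<in> dom Xa" for x
    using a.solution_proj that unfolding Xa P Q by blast
  moreover have "((Some \<circ> Q) \<circ>\<^sub>m Xd \<circ>\<^sub>m (Some \<circ> P)) x = Xd x" if "x \<in> dom Xd" for x
    using d.solution_proj that unfolding Xd P_def Q_def by blast
  moreover have "is_solution r H1 H2 H3 H4 M B C Xd \<and> bounded_operator Xd \<and>
      extension Xd = adj H3 H2 (extension Xa)" if "Y \<in> Y_set r H1 H2 H3 H4 M B C"
    using d.is_solution_solution[OF that] d.solutions_bounded[OF Y] that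
      d.Y_set_iff_range_subset[OF Y] unfolding Xa Xd by blast
  ultimately show ?thesis by simp
qed

end
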